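(* Let $E$ be a symmetric space on $I=[0,\alpha)$ with $\alpha<\infty$. Then $E$ is lower locally uniformly $K$-monotone if and only if $E$ is strictly $K$-monotone and order continuous.
   Context: Let $I=[0,\alpha)$ with Lebesgue measure $\mu$ (the paper's convention is that $\alpha$ is $1$ or $\infty$, so the finite case is $\alpha=1$), and let $L^0$ be the set of (equivalence classes of) extended real valued measurable functions on $I$. A Banach function space $(E,\|\cdot\|_E)$ is a Banach lattice that is a sublattice of $L^0$ such that (1) $x\in L^0$, $y\in E$, $|x|\le|y|$ a.e. imply $x\in E$ and $\|x\|_E\le\|y\|_E$; (2) $E$ contains a strictly positive function. $E^+=\{x\in E:x\ge0\}$. For $x\in L^0$: $d_x(\lambda)=\mu\{s\in I:|x(s)|>\lambda\}$, $x^*(t)=\inf\{\lambda>0:d_x(\lambda)\le t\}$, $x^{**}(t)=\frac1t\int_0^t x^*(s)\,ds$. $E$ is symmetric if $x\in L^0$, $y\in E$, $d_x=d_y$ imply $x\in E$ and $\|x\|_E=\|y\|_E$. Standing assumption: $E$ has the Fatou property, i.e. if $(x_n)\subset E^+$, $\sup_n\|x_n\|_E<\infty$ and $x_n\uparrow x\in L^0$, then $x\in E$ and $\|x_n\|_E\uparrow\|x\|_E$. For $x,y\in L^1+L^\infty$, $x\prec y$ means $x^{**}(t)\le y^{**}(t)$ for all $t>0$. $E$ is order continuous if for every $x\in E$ and every $(x_n)\subset E^+$ with $x_n\le|x|$ and $x_n\to0$ a.e. we have $\|x_n\|_E\to0$. $E$ is strictly $K$-monotone if for all $x,y\in E$ with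 $x^*\ne y^*$ and $y\prec x$ we have $\|y\|_E<\|x\|_E$. $E$ is lower locally uniformly $K$-monotone if for every $x\in E$ and every $(x_n)\subset E$ with $x_n\prec x$ for all $n$ and $\|x_n\|_E\to\|x\|_E$ we have $\|x^*-x_n^*\|_E\to0$. *)

theory Defs
  imports "HOL-Analysis.Analysis"
begin

definition interval :: "ereal \<Rightarrow> real set" where
  "interval \<alpha> = {t. 0 \<le> t \<and> ereal t < \<alpha>}"

abbreviation leb :: "ereal \<Rightarrow> real measure" where
  "leb \<alpha> \<equiv> lebesgue_on (interval \<alpha>)"

text \<open>Elements of $L^0$ are represented by measurable functions; all relations between them are
  read almost everywhere on the interval, and values outside the interval are irrelevant.\<close>

definition L0 :: "ereal \<Rightarrow> (real \<Rightarrow> ereal) set" where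
  "L0 \<alpha> = borel_measurable (leb \<alpha>)"

text \<open>\<open>E\<close> is a set of representatives and \<open>N\<close> its norm (only its values on \<open>E\<close> matter).
  By \<open>ideal\<close>, \<open>E\<close> is closed under almost everywhere equality and \<open>N\<close> respects it, and \<open>N\<close> is a
  lattice norm. The assumption \<open>finite_ae\<close> is implicit in \<open>E\<close> being a vector space under the
  pointwise operations; it makes \<open>\<infinity> - \<infinity>\<close> occur only on null sets.\<close>

locale banach_function_space =
  fixes \<alpha> :: ereal
    and E :: "(real \<Rightarrow> ereal) set"
    and N :: "(real \<Rightarrow> ereal) \<Rightarrow> real"
  assumes alpha: "\<alpha> = 1 \<or> \<alpha> = \<infinity>"
    and subset_L0: "E \<subseteq> L0 \<alpha>"
    and finite_ae: "x \<in> E \<Longrightarrow> AE t in leb \<alpha>. \<bar>x t\<bar> \<noteq> \<infinity>"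
    and add_closed: "x \<in> E \<Longrightarrow> y \<in> E \<Longrightarrow> (\<lambda>t. x t + y t) \<in> E"
    and scale_closed: "x \<in> E \<Longrightarrow> (\<lambda>t. ereal c * x t) \<in> E"
    and sup_closed: "x \<in> E \<Longrightarrow> y \<in> E \<Longrightarrow> (\<lambda>t. sup (x t) (y t)) \<in> E"
    and inf_closed: "x \<in> E \<Longrightarrow> y \<in> E \<Longrightarrow> (\<lambda>t. inf (x t) (y t)) \<in> E"
    and norm_nonneg: "x \<in> E \<Longrightarrow> 0 \<le> N x"
    and norm_eq_zero: "x \<in> E \<Longrightarrow> N x = 0 \<longleftrightarrow> (AE t in leb \<alpha>. x t = 0)"
    and norm_scale: "x \<in> E \<Longrightarrow> N (\<lambda>t. ereal c * x t) = \<bar>c\<bar> * N x"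
    and norm_triangle: "x \<in> E \<Longrightarrow> y \<in> E \<Longrightarrow> N (\<lambda>t. x t + y t) \<le> N x + N y"
    and complete: "(\<And>n. X n \<in> E) \<Longrightarrow>
      (\<forall>e>0. \<exists>n0. \<forall>m\<ge>n0. \<forall>n\<ge>n0. N (\<lambda>t. X m t - X n t) < e) \<Longrightarrow>
      \<exists>x\<in>E. (\<lambda>n. N (\<lambda>t. X n t - x t)) \<longlonglongrightarrow> 0"
    and ideal: "x \<in> L0 \<alpha> \<Longrightarrow> y \<in> E \<Longrightarrow> (AE t in leb \<alpha>. \<bar>x t\<bar> \<le> \<bar>y t\<bar>) \<Longrightarrow>
      x \<in> E \<and> N x \<le> N y"
    and strictly_positive: "\<exists>w\<in>E. AE t in leb \<alpha>. 0 < w t"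

definition pos_cone :: "ereal \<Rightarrow> (real \<Rightarrow> ereal) set \<Rightarrow> (real \<Rightarrow> ereal) set" where
  "pos_cone \<alpha> E = {x \<in> E. AE t in leb \<alpha>. 0 \<le> x t}"

definition distribution :: "ereal \<Rightarrow> (real \<Rightarrow> ereal) \<Rightarrow> real \<Rightarrow> ennreal" where
  "distribution \<alpha> x l = emeasure (leb \<alpha>) {s \<in> interval \<alpha>. \<bar>x s\<bar> > ereal l}"

text \<open>The infimum of the empty set is \<open>\<infinity>\<close>; for finite \<open>\<alpha>\<close> the rearrangement vanishes on
  \<open>[\<alpha>, \<infinity>)\<close>.\<close>

definition rearrangement :: "ereal \<Rightarrow> (real \<Rightarrow> ereal) \<Rightarrow> real \<Rightarrow> ereal" where
  "rearrangement \<alpha> x t = Inf {ereal l | l. 0 < l \<and> distribution \<alpha> x l \<le> ennreal t}"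

definition maximal_fun :: "ereal \<Rightarrow> (real \<Rightarrow> ereal) \<Rightarrow> real \<Rightarrow> ennreal" where
  "maximal_fun \<alpha> x t =
    (1 / ennreal t) * (\<integral>\<^sup>+ s. e2ennreal (rearrangement \<alpha> x s) \<partial>(lebesgue_on {0..t}))"

text \<open>Stated for arbitrary functions, the maximal function possibly being \<open>\<infinity>\<close>; on
  \<open>L\<^sup>1 + L\<^sup>\<infinity>\<close>, which contains every symmetric space, it is finite for \<open>t > 0\<close>.\<close>

definition submajorized :: "ereal \<Rightarrow> (real \<Rightarrow> ereal) \<Rightarrow> (real \<Rightarrow> ereal) \<Rightarrow> bool" where
  "submajorized \<alpha> x y \<longleftrightarrow> (\<forall>t>0. maximal_fun \<alpha> x t \<le> maximal_fun \<alpha> y t)"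

locale symmetric_space = banach_function_space +
  assumes symmetric: "x \<in> L0 \<alpha> \<Longrightarrow> y \<in> E \<Longrightarrow>
      (\<And>l. 0 \<le> l \<Longrightarrow> distribution \<alpha> x l = distribution \<alpha> y l) \<Longrightarrow> x \<in> E \<and> N x = N y"

definition fatou_property ::
    "ereal \<Rightarrow> (real \<Rightarrow> ereal) set \<Rightarrow> ((real \<Rightarrow> ereal) \<Rightarrow> real) \<Rightarrow> bool" where
  "fatou_property \<alpha> E N \<longleftrightarrow>
    (\<forall>X. \<forall>x\<in>L0 \<alpha>.
      (\<forall>n. X n \<in> pos_cone \<alpha> E) \<and> bdd_above (range (\<lambda>n. N (X n))) \<and>
      (AE t in leb \<alpha>. incseq (\<lambda>n. X n t) \<and> (\<lambda>n. X n t) \<longlonglongrightarrow> x t) \<longrightarrow>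
      x \<in> E \<and> incseq (\<lambda>n. N (X n)) \<and> (\<lambda>n. N (X n)) \<longlonglongrightarrow> N x)"

definition order_continuous ::
    "ereal \<Rightarrow> (real \<Rightarrow> ereal) set \<Rightarrow> ((real \<Rightarrow> ereal) \<Rightarrow> real) \<Rightarrow> bool" where
  "order_continuous \<alpha> E N \<longleftrightarrow>
    (\<forall>x\<in>E. \<forall>X.
      (\<forall>n. X n \<in> pos_cone \<alpha> E \<and> (AE t in leb \<alpha>. X n t \<le> \<bar>x t\<bar>)) \<and>
      (AE t in leb \<alpha>. (\<lambda>n. X n t) \<longlonglongrightarrow> 0) \<longrightarrow>
      (\<lambda>n. N (X n)) \<longlonglongrightarrow> 0)"

definition strictly_K_monotone ::
    "ereal \<Rightarrow> (real \<Rightarrow> ereal) set \<Rightarrow> ((real \<Rightarrow> ereal) \<Rightarrow> real) \<Rightarrow> bool" where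
  "strictly_K_monotone \<alpha> E N \<longleftrightarrow>
    (\<forall>x\<in>E. \<forall>y\<in>E.
      (\<exists>t\<in>interval \<alpha>. rearrangement \<alpha> x t \<noteq> rearrangement \<alpha> y t) \<and> submajorized \<alpha> y x \<longrightarrow>
      N y < N x)"

definition lower_locally_uniformly_K_monotone ::
    "ereal \<Rightarrow> (real \<Rightarrow> ereal) set \<Rightarrow> ((real \<Rightarrow> ereal) \<Rightarrow> real) \<Rightarrow> bool" where
  "lower_locally_uniformly_K_monotone \<alpha> E N \<longleftrightarrow>
    (\<forall>x\<in>E. \<forall>X.
      (\<forall>n. X n \<in> E \<and> submajorized \<alpha> (X n) x) \<and> (\<lambda>n. N (X n)) \<longlonglongrightarrow> N x \<longrightarrow>
      (\<lambda>n. N (\<lambda>t. rearrangement \<alpha> x t - rearrangement \<alpha> (X n) t)) \<longlonglongrightarrow> 0)"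

end

theory Submission
  imports Defs "HOL-Library.Diagonal_Subsequence"
begin

text \<open>Write \<open>y \<prec> x\<close> for submajorization.

  If \<open>E\<close> is lower locally uniformly \<open>K\<close>-monotone, constant sequences show that
  \<open>y \<prec> x\<close> and \<open>\<parallel>y\<parallel> = \<parallel>x\<parallel>\<close> force \<open>y\<^sup>* = x\<^sup>*\<close>. Were \<open>\<parallel>y\<parallel> > \<parallel>x\<parallel>\<close>, this would apply to \<open>s y\<close> with
  \<open>s = \<parallel>x\<parallel> / \<parallel>y\<parallel> < 1\<close>, and \<open>s y\<^sup>* = x\<^sup>*\<close> contradicts \<open>y \<prec> x\<close>; so strict \<open>K\<close>-monotonicity needs no
  Calderon-type interpolation theorem. By the Fatou property the hypothesis also applies to
  \<open>min \<bar>x\<bar> m \<up> \<bar>x\<bar>\<close> and to \<open>\<chi>\<^bsub>[1/k,1)\<^esub> \<up> 1\<close>; hence bounded functions are dense and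
  \<open>\<parallel>\<chi>\<^bsub>B\<^esub>\<parallel> \<rightarrow> 0\<close> as \<open>\<mu> B \<rightarrow> 0\<close>, which gives order continuity.

  Conversely, let \<open>x\<^sub>n \<prec> x\<close> with \<open>\<parallel>x\<^sub>n\<parallel> \<rightarrow> \<parallel>x\<parallel>\<close>. By Helly selection a subsequence of \<open>x\<^sub>n\<^sup>*\<close> converges
  almost everywhere to some \<open>y \<prec> x\<close>, and \<open>y \<in> E\<close> by the Fatou property. On \<open>[0,d)\<close> all norms are
  controlled by \<open>\<parallel>x\<^sup>* \<chi>\<^bsub>[0,d)\<^esub>\<parallel>\<close>, which is small, and on \<open>[d,1)\<close> all functions are bounded by
  \<open>x\<^sup>*\<^sup>*(d)\<close>; so the subsequence converges to \<open>y\<close> in norm. Then \<open>\<parallel>y\<parallel> = \<parallel>x\<parallel>\<close>, and strict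
  \<open>K\<close>-monotonicity yields \<open>y = x\<^sup>*\<close>.\<close>

section \<open>Decreasing rearrangements\<close>

lemma interval_one: "interval 1 = {0..<1}"
  by (auto simp: interval_def one_ereal_def)

lemma emeasure_leb_one: "A \<subseteq> {0..<1} \<Longrightarrow> emeasure (leb 1) A = emeasure lebesgue A"
  by (simp add: interval_one emeasure_restrict_space)

text \<open>Nonnegative extended reals are tested against real levels only, the form in which
  \<open>less_rearrangement_iff\<close> describes a rearrangement.\<close>

lemma ereal_eqI:
  fixes a b :: ereal
  assumes "0 \<le> a" "0 \<le> b" "\<And>l. 0 \<le> l \<Longrightarrow> ereal l < a \<longleftrightarrow> ereal l < b"
  shows "a = b"
proof -
  have "u \<le> v" if "0 \<le> v" "\<And>l. 0 \<le> l \<Longrightarrow> ereal l < u \<Longrightarrow> ereal l < v" for u v :: ereal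
  proof (rule ccontr)
    assume "\<not> u \<le> v"
    then obtain l where l: "v < ereal l" "ereal l < u"
      using ereal_dense2[of v u] by (auto simp: not_le)
    with \<open>0 \<le> v\<close> have "0 \<le> l"
      by (metis ereal_less_eq(5) less_imp_le order_trans)
    with that(2)[OF this l(2)] l(1) show False by simp
  qed
  with assms show ?thesis by (metis antisym)
qed

lemma distribution_sets:
  assumes "x \<in> L0 \<alpha>"
  shows "{s \<in> interval \<alpha>. ereal l < \<bar>x s\<bar>} \<in> sets (leb \<alpha>)"
proof -
  have "x \<in> borel_measurable (leb \<alpha>)"
    using assms by (simp add: L0_def)
  then have "{s \<in> space (leb \<alpha>). ereal l < \<bar>x s\<bar>} \<in> sets (leb \<alpha>)"
    by measurable
  then show ?thesis by simp
qed

lemma distribution_antimono: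
  assumes "x \<in> L0 \<alpha>" "l \<le> l'"
  shows "distribution \<alpha> x l' \<le> distribution \<alpha> x l"
proof -
  have "{s \<in> interval \<alpha>. ereal l' < \<bar>x s\<bar>} \<subseteq> {s \<in> interval \<alpha>. ereal l < \<bar>x s\<bar>}"
    using assms(2) le_less_trans[of "ereal l" "ereal l'"] by fastforce
  then show ?thesis
    unfolding distribution_def by (intro emeasure_mono distribution_sets assms)
qed

text \<open>The sets where \<open>\<bar>x\<bar>\<close> exceeds \<open>l + 1 / (n + 1)\<close>
  increase to the set where it exceeds \<open>l\<close>, so their measures converge by continuity
  from below.\<close>

lemma distribution_right_continuous:
  assumes "x \<in> L0 \<alpha>" "c < distribution \<alpha> x l"
  shows "\<exists>l'>l. c < distribution \<alpha> x l'"
proof -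
  let ?A = "\<lambda>n. {s \<in> interval \<alpha>. ereal (l + 1 / real (Suc n)) < \<bar>x s\<bar>}"
  have "incseq ?A"
  proof (rule incseq_SucI)
    fix n
    have *: "ereal (l + 1 / real (Suc (Suc n))) \<le> ereal (l + 1 / real (Suc n))"
      by (simp add: frac_le)
    show "?A n \<subseteq> ?A (Suc n)"
      using le_less_trans[OF *] by blast
  qed
  moreover have "range ?A \<subseteq> sets (leb \<alpha>)"
    using distribution_sets[OF assms(1)] by (simp add: image_subset_iff)
  moreover have "(\<Union>n. ?A n) = {s \<in> interval \<alpha>. ereal l < \<bar>x s\<bar>}" (is "_ = ?B")
  proof (intro equalityI subsetI)
    fix s assume "s \<in> (\<Union>n. ?A n)"
    then obtain n where n: "s \<in> ?A n" by blast
    have "ereal l < ereal (l + 1 / real (Suc n))" by simp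
    also have "\<dots> < \<bar>x s\<bar>" using n by simp
    finally show "s \<in> ?B" using n by simp
  next
    fix s assume s: "s \<in> ?B"
    then obtain r where r: "ereal l < ereal r" "ereal r < \<bar>x s\<bar>"
      using ereal_dense2[of "ereal l" "\<bar>x s\<bar>"] by auto
    then obtain n where "inverse (real (Suc n)) < r - l"
      using reals_Archimedean[of "r - l"] by auto
    then have "ereal (l + 1 / real (Suc n)) < ereal r"
      by (simp add: inverse_eq_divide)
    with r(2) have "ereal (l + 1 / real (Suc n)) < \<bar>x s\<bar>" using less_trans by blast
    with s show "s \<in> (\<Union>n. ?A n)" by blast
  qed
  ultimately have "(SUP n. distribution \<alpha> x (l + 1 / real (Suc n))) = distribution \<alpha> x l"
    using SUP_emeasure_incseq[of ?A "leb \<alpha>"] by (simp add: distribution_def)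
  with assms(2) have "c < (SUP n. distribution \<alpha> x (l + 1 / real (Suc n)))" by simp
  then obtain n where "c < distribution \<alpha> x (l + 1 / real (Suc n))"
    unfolding less_SUP_iff by blast
  then show ?thesis
    by (intro exI[of _ "l + 1 / real (Suc n)"]) simp
qed

text \<open>Rearrangement and distribution function are generalized inverses of each other. All
  later computations of rearrangements go through this equivalence. Right continuity of the
  distribution makes the strict inequalities match.\<close>

lemma less_rearrangement_iff:
  assumes "x \<in> L0 \<alpha>" "0 \<le> l"
  shows "ereal l < rearrangement \<alpha> x t \<longleftrightarrow> ennreal t < distribution \<alpha> x l"
proof
  assume "ennreal t < distribution \<alpha> x l"
  then obtain l' where l': "l < l'" "ennreal t < distribution \<alpha> x l'"
    using distribution_right_continuous[OF assms(1)] by blast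
  have "ereal l' \<le> rearrangement \<alpha> x t"
    unfolding rearrangement_def
  proof (rule Inf_greatest, clarsimp)
    fix k assume "distribution \<alpha> x k \<le> ennreal t"
    then show "l' \<le> k"
      using distribution_antimono[OF assms(1), of k l'] l'(2) by fastforce
  qed
  with l'(1) show "ereal l < rearrangement \<alpha> x t"
    by (metis ereal_less(2) less_ereal.simps(1) less_le_trans)
next
  assume less: "ereal l < rearrangement \<alpha> x t"
  show "ennreal t < distribution \<alpha> x l"
  proof (rule ccontr)
    assume "\<not> ennreal t < distribution \<alpha> x l"
    then have d: "distribution \<alpha> x l \<le> ennreal t" by simp
    \<comment> \<open>The infimum ranges over positive levels only and \<open>l\<close> may be 0,
      hence the detour through \<open>l + e\<close>.\<close>
    have "rearrangement \<alpha> x t \<le> ereal l + ereal e" if "0 < e" for e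
      unfolding rearrangement_def
    proof (rule Inf_lower)
      have "distribution \<alpha> x (l + e) \<le> ennreal t"
        using distribution_antimono[OF assms(1), of l "l + e"] d that by auto
      then show "ereal l + ereal e \<in> {ereal l |l. 0 < l \<and> distribution \<alpha> x l \<le> ennreal t}"
        using that assms(2) by auto
    qed
    then have "rearrangement \<alpha> x t \<le> ereal l"
      by (rule ereal_le_epsilon2)
    with less show False by simp
  qed
qed

lemma rearrangement_nonneg: "0 \<le> rearrangement \<alpha> x t"
  unfolding rearrangement_def by (rule Inf_greatest) auto

lemma rearrangement_antimono: "s \<le> t \<Longrightarrow> rearrangement \<alpha> x t \<le> rearrangement \<alpha> x s"
proof -
  assume "s \<le> t"
  then have "d \<le> ennreal s \<Longrightarrow> d \<le> ennreal t" for d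
    using ennreal_leI order_trans by metis
  then show ?thesis
    unfolding rearrangement_def by (intro Inf_superset_mono) blast
qed

lemma rearrangement_mono:
  assumes "\<And>l. 0 \<le> l \<Longrightarrow> distribution \<alpha> x l \<le> distribution \<alpha> y l"
  shows "rearrangement \<alpha> x t \<le> rearrangement \<alpha> y t"
proof -
  have "0 < l \<Longrightarrow> distribution \<alpha> y l \<le> d \<Longrightarrow> distribution \<alpha> x l \<le> d" for l d
    using assms[of l] by simp
  then show ?thesis
    unfolding rearrangement_def by (intro Inf_superset_mono) blast
qed

lemma rearrangement_cong:
  assumes "\<And>l. 0 \<le> l \<Longrightarrow> distribution \<alpha> x l = distribution \<alpha> y l"
  shows "rearrangement \<alpha> x = rearrangement \<alpha> y"
  using assms by (intro ext antisym rearrangement_mono) auto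

lemma distribution_cong_AE:
  assumes "x \<in> L0 \<alpha>" "y \<in> L0 \<alpha>" "AE t in leb \<alpha>. x t = y t"
  shows "distribution \<alpha> x l = distribution \<alpha> y l"
  unfolding distribution_def
  using assms by (intro emeasure_eq_AE distribution_sets) auto

lemma rearrangement_cong_AE:
  assumes "x \<in> L0 \<alpha>" "y \<in> L0 \<alpha>" "AE t in leb \<alpha>. x t = y t"
  shows "rearrangement \<alpha> x = rearrangement \<alpha> y"
  using assms by (intro rearrangement_cong distribution_cong_AE)

lemma rearrangement_borel:
  assumes "x \<in> L0 \<alpha>"
  shows "rearrangement \<alpha> x \<in> borel_measurable borel"
proof (rule borel_measurableI_greater)
  fix a :: ereal
  consider "a < 0" | "a = \<infinity>" | l where "a = ereal l" "0 \<le> l"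
    by (cases a) (auto simp: not_less[symmetric])
  then show "{t \<in> space borel. a < rearrangement \<alpha> x t} \<in> sets borel"
  proof cases
    case 1
    then have "a < rearrangement \<alpha> x t" for t
      using rearrangement_nonneg less_le_trans by blast
    then show ?thesis by simp
  next
    case 2
    then show ?thesis by simp
  next
    case 3
    then have "{t. a < rearrangement \<alpha> x t} = {t. ennreal t < distribution \<alpha> x l}"
      using less_rearrangement_iff[OF assms] by auto
    then show ?thesis by simp
  qed
qed

lemma rearrangement_measurable:
  assumes "x \<in> L0 \<alpha>"
  shows "rearrangement \<alpha> x \<in> borel_measurable lebesgue"
    "rearrangement \<alpha> x \<in> borel_measurable (lebesgue_on S)"
proof -
  show "rearrangement \<alpha> x \<in> borel_measurable lebesgue"
    using rearrangement_borel[OF assms] by (auto intro: measurable_completion)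
  then show "rearrangement \<alpha> x \<in> borel_measurable (lebesgue_on S)"
    by (rule measurable_restrict_space1)
qed

lemma rearrangement_L0: "x \<in> L0 \<alpha> \<Longrightarrow> rearrangement \<alpha> x \<in> L0 \<beta>"
  by (simp add: L0_def rearrangement_measurable[unfolded L0_def])

lemma distribution_le_1: "distribution 1 x l \<le> 1"
proof -
  have "emeasure (leb 1) (space (leb 1)) = 1"
    by (simp add: interval_one emeasure_restrict_space)
  then show ?thesis
    using emeasure_space[of "leb 1" "{s \<in> interval 1. ereal l < \<bar>x s\<bar>}"]
    unfolding distribution_def by simp
qed

lemma emeasure_leb_one_initial:
  assumes "c \<le> 1"
  shows "emeasure (leb 1) {s \<in> interval 1. ennreal s < c} = c"
proof -
  obtain r where r: "c = ennreal r" "0 \<le> r" "r \<le> 1"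
    using assms by (cases c) (auto simp: top_unique)
  then have "{s \<in> interval 1. ennreal s < c} = {0..<r}"
    by (auto simp: interval_one ennreal_less_iff)
  with r show ?thesis
    by (simp add: interval_one emeasure_restrict_space)
qed

text \<open>By \<open>less_rearrangement_iff\<close> the rearrangement exceeds \<open>l\<close>
  exactly on the initial segment of length \<open>distribution 1 x l\<close>, which fits into the
  interval because that length is at most 1.\<close>

lemma distribution_rearrangement:
  assumes "x \<in> L0 1" "0 \<le> l"
  shows "distribution 1 (rearrangement 1 x) l = distribution 1 x l"
proof -
  have "{s \<in> interval 1. ereal l < \<bar>rearrangement 1 x s\<bar>}
      = {s \<in> interval 1. ennreal s < distribution 1 x l}"
    using less_rearrangement_iff[OF assms] by (simp add: rearrangement_nonneg)
  then show ?thesis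
    unfolding distribution_def[of _ "rearrangement 1 x"]
    using emeasure_leb_one_initial[OF distribution_le_1] by simp
qed

lemma rearrangement_idem:
  "x \<in> L0 1 \<Longrightarrow> rearrangement 1 (rearrangement 1 x) = rearrangement 1 x"
  by (intro rearrangement_cong distribution_rearrangement)

text \<open>By monotonicity the part of the interval where \<open>x\<close> exceeds \<open>l\<close>
  is an initial segment of length \<open>?d l\<close>. This gives one inequality everywhere; the
  other can fail only at jumps of \<open>x\<close>, since rearrangements are right
  continuous.\<close>

lemma rearrangement_antimono_AE:
  assumes "x \<in> L0 1" and nonneg: "\<And>t. t \<in> {0..<1} \<Longrightarrow> 0 \<le> x t"
    and anti: "\<And>s t. 0 \<le> s \<Longrightarrow> s \<le> t \<Longrightarrow> t < 1 \<Longrightarrow> x t \<le> x s"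
  shows "AE t in leb 1. rearrangement 1 x t = x t"
proof -
  let ?d = "distribution 1 x"
  have below: "ereal l < x t" if "ennreal t < ?d l" "0 \<le> t" for l t
  proof (rule ccontr)
    assume *: "\<not> ereal l < x t"
    have "s \<le> t" if s: "s \<in> {0..<1}" "ereal l < x s" for s
      using anti[of t s] s * \<open>0 \<le> t\<close> by (metis atLeastLessThan_iff less_le_trans linear)
    then have "{s \<in> interval 1. ereal l < \<bar>x s\<bar>} \<subseteq> {0..t}"
      using nonneg by (auto simp: interval_one)
    then have "emeasure lebesgue {s \<in> interval 1. ereal l < \<bar>x s\<bar>} \<le> emeasure lebesgue {0..t}"
      by (intro emeasure_mono) auto
    moreover have "?d l = emeasure lebesgue {s \<in> interval 1. ereal l < \<bar>x s\<bar>}"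
      unfolding distribution_def by (rule emeasure_leb_one) (auto simp: interval_one)
    ultimately have "?d l \<le> ennreal t"
      using that(2) by simp
    with that(1) show False by simp
  qed
  have above: "ennreal t \<le> ?d l" if "ereal l < x t" "t \<in> {0..<1}" for l t
  proof -
    have "{0..t} \<subseteq> {s \<in> interval 1. ereal l < \<bar>x s\<bar>}"
    proof
      fix s assume s: "s \<in> {0..t}"
      then have "ereal l < x s"
        using that anti[of s t] by (auto intro: less_le_trans)
      with s that nonneg[of s] show "s \<in> {s \<in> interval 1. ereal l < \<bar>x s\<bar>}"
        by (simp add: interval_one)
    qed
    then have "emeasure (leb 1) {0..t} \<le> ?d l"
      unfolding distribution_def by (intro emeasure_mono distribution_sets assms)
    moreover have "emeasure (leb 1) {0..t} = ennreal t"
      using that(2) by (subst emeasure_leb_one) auto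
    ultimately show ?thesis by simp
  qed
  have le: "rearrangement 1 x t \<le> x t" if "t \<in> {0..<1}" for t
  proof (rule ccontr)
    assume "\<not> rearrangement 1 x t \<le> x t"
    then obtain l where l: "x t < ereal l" "ereal l < rearrangement 1 x t"
      using ereal_dense2[of "x t" "rearrangement 1 x t"] by (auto simp: not_le)
    then have "0 \<le> l" using nonneg[OF that] by (metis ereal_less_eq(5) less_imp_le order_trans)
    with l below[of t l] that show False
      using less_rearrangement_iff[OF assms(1), of l t] by auto
  qed
  \<comment> \<open>An exceptional point \<open>t\<close> equals \<open>d\<^sub>x(q)\<close> for every rational \<open>q\<close> between the two values.\<close>
  let ?B = "{t \<in> {0..<1}. rearrangement 1 x t < x t}"
  have "?B \<subseteq> (\<lambda>q. enn2real (?d (of_rat q))) ` UNIV"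
  proof
    fix t assume t: "t \<in> ?B"
    then obtain r where r: "rearrangement 1 x t < ereal r" "ereal r < x t"
      using ereal_dense2[of "rearrangement 1 x t" "x t"] by auto
    then obtain r' where r': "ereal r < ereal r'" "ereal r' < x t"
      using ereal_dense2[of "ereal r" "x t"] by auto
    then obtain q where q: "r < of_rat q" "of_rat q < r'"
      using of_rat_dense[of r r'] by auto
    have lq: "rearrangement 1 x t < ereal (of_rat q)"
      using less_trans[OF r(1), of "ereal (of_rat q)"] q by simp
    have qx: "ereal (of_rat q) < x t"
      using less_trans[of "ereal (of_rat q)" "ereal r'" "x t"] r' q by simp
    have "0 \<le> (of_rat q :: real)"
      using order_trans[OF rearrangement_nonneg[of 1 x t] less_imp_le[OF lq]] by simp
    then have "?d (of_rat q) \<le> ennreal t"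
      using less_rearrangement_iff[OF assms(1), of "of_rat q" t] lq by (meson not_less less_asym)
    moreover have "ennreal t \<le> ?d (of_rat q)"
      using above[OF qx] t by simp
    ultimately have "t = enn2real (?d (of_rat q))" using t by (simp add: antisym)
    then show "t \<in> (\<lambda>q. enn2real (?d (of_rat q))) ` UNIV" by blast
  qed
  then have "countable ?B" by (meson countable_image countable_subset countableI_type)
  then have "?B \<in> null_sets lebesgue"
    by (simp add: countable_imp_null_set_lborel null_sets_completionI)
  then have "AE t in lebesgue. t \<notin> ?B" by (rule AE_not_in)
  then have "AE t in lebesgue. t \<in> interval 1 \<longrightarrow> rearrangement 1 x t = x t"
  proof eventually_elim
    case (elim t)
    with le[of t] show ?case by (auto simp: interval_one)
  qed
  then show ?thesis
    by (subst AE_restrict_space_iff) (auto simp: interval_one)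
qed

lemma AE_leb_one_iff: "(AE s in leb 1. P s) \<longleftrightarrow> (AE s in lebesgue. s \<in> {0..<1} \<longrightarrow> P s)"
  by (subst AE_restrict_space_iff) (auto simp: interval_one)

section \<open>Submajorization through integrals of rearrangements\<close>

definition rearrangement_integral :: "ereal \<Rightarrow> (real \<Rightarrow> ereal) \<Rightarrow> real \<Rightarrow> ennreal" where
  "rearrangement_integral \<alpha> x t =
    (\<integral>\<^sup>+ s. e2ennreal (rearrangement \<alpha> x s) \<partial>(lebesgue_on {0..t}))"

lemma submajorized_iff:
  "submajorized \<alpha> x y \<longleftrightarrow>
    (\<forall>t>0. rearrangement_integral \<alpha> x t \<le> rearrangement_integral \<alpha> y t)"
proof -
  have "maximal_fun \<alpha> x t \<le> maximal_fun \<alpha> y t \<longleftrightarrow>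
      rearrangement_integral \<alpha> x t \<le> rearrangement_integral \<alpha> y t" if "0 < t" for t
  proof -
    have "1 / ennreal t = ennreal (1 / t)"
      using that divide_ennreal[of 1 t] by simp
    then show ?thesis
      using that by (simp add: maximal_fun_def rearrangement_integral_def ennreal_mult_le_mult_iff)
  qed
  then show ?thesis
    by (simp add: submajorized_def)
qed

lemma distribution_scale:
  assumes "0 < c"
  shows "distribution \<alpha> (\<lambda>t. ereal c * x t) l = distribution \<alpha> x (l / c)"
proof -
  have "ereal l < \<bar>ereal c * x s\<bar> \<longleftrightarrow> ereal (l / c) < \<bar>x s\<bar>" for s
    using assms by (cases "x s") (auto simp: abs_mult pos_divide_less_eq mult.commute)
  then show ?thesis by (simp add: distribution_def)
qed

lemma scale_L0: "x \<in> L0 \<alpha> \<Longrightarrow> (\<lambda>t. ereal c * x t) \<in> L0 \<alpha>"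
  by (simp add: L0_def)

lemma rearrangement_scale:
  assumes "x \<in> L0 \<alpha>" "0 < c"
  shows "rearrangement \<alpha> (\<lambda>t. ereal c * x t) t = ereal c * rearrangement \<alpha> x t"
proof (rule ereal_eqI)
  show "0 \<le> ereal c * rearrangement \<alpha> x t"
    using assms(2) rearrangement_nonneg[of \<alpha> x t] by simp
  fix l :: real assume "0 \<le> l"
  have "ereal l < rearrangement \<alpha> (\<lambda>t. ereal c * x t) t \<longleftrightarrow> ereal (l / c) < rearrangement \<alpha> x t"
    using assms \<open>0 \<le> l\<close> by (simp add: less_rearrangement_iff scale_L0 distribution_scale)
  also have "\<dots> \<longleftrightarrow> ereal l < ereal c * rearrangement \<alpha> x t"
    using assms(2) by (cases "rearrangement \<alpha> x t") (auto simp: pos_divide_less_eq mult.commute)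
  finally show "ereal l < rearrangement \<alpha> (\<lambda>t. ereal c * x t) t \<longleftrightarrow>
      ereal l < ereal c * rearrangement \<alpha> x t" .
qed (rule rearrangement_nonneg)

lemma rearrangement_integral_scale:
  assumes "x \<in> L0 \<alpha>" "0 < c"
  shows "rearrangement_integral \<alpha> (\<lambda>t. ereal c * x t) t =
    ennreal c * rearrangement_integral \<alpha> x t"
proof -
  have "e2ennreal (ereal c * u) = ennreal c * e2ennreal u" if "0 \<le> u" for u
    using that assms(2)
    by (cases u) (auto simp: e2ennreal_ereal e2ennreal_infty ennreal_mult ennreal_mult_top)
  then show ?thesis
    using assms rearrangement_measurable(2)[OF assms(1)]
    by (simp add: rearrangement_integral_def rearrangement_scale rearrangement_nonneg
        nn_integral_cmult)
qed

lemma rearrangement_eq_0: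
  assumes "1 \<le> t" "x \<in> L0 1"
  shows "rearrangement 1 x t = 0"
proof (rule ereal_eqI)
  fix l :: real assume "0 \<le> l"
  have "distribution 1 x l \<le> ennreal t"
    using distribution_le_1[of x l] assms(1) by (metis ennreal_1 ennreal_leI order_trans)
  then show "ereal l < rearrangement 1 x t \<longleftrightarrow> ereal l < 0"
    using less_rearrangement_iff[OF assms(2) \<open>0 \<le> l\<close>, of t] \<open>0 \<le> l\<close> by (auto simp: not_less[symmetric])
qed (simp_all add: rearrangement_nonneg)

text \<open>A decreasing function can be integrated without being rearranged. The factor for
  \<open>{0..<1}\<close> is there because \<open>x\<close> is arbitrary outside the interval,
  whereas its rearrangement vanishes from 1 on.\<close>

lemma rearrangement_integral_eq_antimono:
  assumes "x \<in> L0 1" "\<And>t. t \<in> {0..<1} \<Longrightarrow> 0 \<le> x t"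
    "\<And>s t. 0 \<le> s \<Longrightarrow> s \<le> t \<Longrightarrow> t < 1 \<Longrightarrow> x t \<le> x s"
  shows "rearrangement_integral 1 x t =
    (\<integral>\<^sup>+ s. e2ennreal (x s) * indicator ({0..t} \<inter> {0..<1}) s \<partial>lebesgue)"
proof -
  have "AE s in lebesgue. s \<in> {0..<1} \<longrightarrow> rearrangement 1 x s = x s"
    using rearrangement_antimono_AE[OF assms(1)] assms(2,3) by (simp add: AE_leb_one_iff)
  then have "AE s in lebesgue. e2ennreal (rearrangement 1 x s) * indicator {0..t} s =
      e2ennreal (x s) * indicator ({0..t} \<inter> {0..<1}) s"
  proof eventually_elim
    case (elim s)
    then show ?case
      using rearrangement_eq_0[of s x] assms(1) by (auto simp: indicator_def e2ennreal_neg)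
  qed
  then show ?thesis
    unfolding rearrangement_integral_def
    by (subst nn_integral_restrict_space) (auto intro!: nn_integral_cong_AE)
qed

section \<open>Restriction to an initial interval \<open>[0,d)\<close>\<close>

definition cut :: "real \<Rightarrow> (real \<Rightarrow> ereal) \<Rightarrow> real \<Rightarrow> ereal" where
  "cut d x = (\<lambda>s. if s < d then x s else 0)"

lemma measurable_If_less:
  assumes "f \<in> borel_measurable (leb \<alpha>)" "g \<in> borel_measurable (leb \<alpha>)"
  shows "(\<lambda>s. if s < d then f s else g s) \<in> borel_measurable (leb \<alpha>)"
proof -
  have "{s \<in> space (leb \<alpha>). s < d} \<in> sets (leb \<alpha>)"
    by (auto simp: sets_restrict_space image_iff intro!: bexI[of _ "{..<d}"])
  then show ?thesis using assms by (intro measurable_If) auto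
qed

lemma cut_L0: "x \<in> L0 \<alpha> \<Longrightarrow> cut d x \<in> L0 \<alpha>"
  unfolding L0_def cut_def by (intro measurable_If_less) auto

lemma rearrangement_integral_cut:
  assumes "x \<in> L0 1" "\<And>t. t \<in> {0..<1} \<Longrightarrow> 0 \<le> x t"
    "\<And>s t. 0 \<le> s \<Longrightarrow> s \<le> t \<Longrightarrow> t < 1 \<Longrightarrow> x t \<le> x s"
  shows "rearrangement_integral 1 (cut d x) t = rearrangement_integral 1 x (min t d)"
proof -
  have "rearrangement_integral 1 (cut d x) t =
      (\<integral>\<^sup>+ s. e2ennreal (cut d x s) * indicator ({0..t} \<inter> {0..<1}) s \<partial>lebesgue)"
    using assms by (intro rearrangement_integral_eq_antimono cut_L0) (auto simp: cut_def)
  also have "\<dots> = (\<integral>\<^sup>+ s. e2ennreal (x s) * indicator ({0..min t d} \<inter> {0..<1}) s \<partial>lebesgue)"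
  proof (rule nn_integral_cong_AE)
    \<comment> \<open>The cut is strict at \<open>d\<close>, but the interval
      \<open>{0..min t d}\<close> is closed; the two integrands may differ there.\<close>
    have "AE s in lebesgue. s \<noteq> d"
      by (rule AE_completion) (rule AE_lborel_singleton)
    then show "AE s in lebesgue. e2ennreal (cut d x s) * indicator ({0..t} \<inter> {0..<1}) s =
        e2ennreal (x s) * indicator ({0..min t d} \<inter> {0..<1}) s"
      by eventually_elim (auto simp: cut_def indicator_def e2ennreal_neg)
  qed
  also have "\<dots> = rearrangement_integral 1 x (min t d)"
    by (rule rearrangement_integral_eq_antimono[OF assms, symmetric])
  finally show ?thesis .
qed

text \<open>For decreasing functions the cut merely replaces \<open>t\<close> by
  \<open>min t d\<close> in both integrals, and this is again a positive argument.\<close>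

lemma submajorized_cut:
  assumes "x \<in> L0 1" "\<And>t. t \<in> {0..<1} \<Longrightarrow> 0 \<le> x t"
    "\<And>s t. 0 \<le> s \<Longrightarrow> s \<le> t \<Longrightarrow> t < 1 \<Longrightarrow> x t \<le> x s"
    and "y \<in> L0 1" "\<And>t. t \<in> {0..<1} \<Longrightarrow> 0 \<le> y t"
    "\<And>s t. 0 \<le> s \<Longrightarrow> s \<le> t \<Longrightarrow> t < 1 \<Longrightarrow> y t \<le> y s"
    and "submajorized 1 x y" "0 < d"
  shows "submajorized 1 (cut d x) (cut d y)"
  using assms(7,8) rearrangement_integral_cut[OF assms(1-3)] rearrangement_integral_cut[OF assms(4-6)]
  by (simp add: submajorized_iff)

text \<open>A Chebyshev bound: away from 0 a rearrangement is controlled by its integral, hence by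
  submajorization.\<close>

lemma rearrangement_integral_ge:
  assumes "0 \<le> t"
  shows "ennreal t * e2ennreal (rearrangement \<alpha> x t) \<le> rearrangement_integral \<alpha> x t"
proof -
  have "ennreal t * e2ennreal (rearrangement \<alpha> x t) =
      (\<integral>\<^sup>+ s. e2ennreal (rearrangement \<alpha> x t) \<partial>(lebesgue_on {0..t}))"
    using assms by (simp add: emeasure_restrict_space mult.commute)
  also have "\<dots> \<le> rearrangement_integral \<alpha> x t"
    unfolding rearrangement_integral_def
    by (rule nn_integral_mono) (simp add: e2ennreal_mono rearrangement_antimono)
  finally show ?thesis .
qed

text \<open>Beyond \<open>t'\<close> the integrand is at most its value at \<open>t'\<close>. Once
  that value is known to be finite, finiteness of the integral no longer depends on the
  endpoint.\<close>

lemma rearrangement_integral_le: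
  assumes "x \<in> L0 \<alpha>" "0 \<le> t" "0 \<le> t'"
  shows "rearrangement_integral \<alpha> x t \<le>
    rearrangement_integral \<alpha> x t' + ennreal t * e2ennreal (rearrangement \<alpha> x t')"
proof -
  let ?r = "\<lambda>s. e2ennreal (rearrangement \<alpha> x s)"
  have [measurable]: "?r \<in> borel_measurable lebesgue" "{0..a} \<in> sets lebesgue" for a :: real
    using rearrangement_measurable(1)[OF assms(1)] by auto
  have "rearrangement_integral \<alpha> x t = (\<integral>\<^sup>+ s. ?r s * indicator {0..t} s \<partial>lebesgue)"
    unfolding rearrangement_integral_def by (subst nn_integral_restrict_space) auto
  also have "\<dots> \<le> (\<integral>\<^sup>+ s. ?r s * indicator {0..t'} s + ?r t' * indicator {0..t} s \<partial>lebesgue)"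
    by (rule nn_integral_mono)
      (auto simp: indicator_def add_increasing intro!: e2ennreal_mono rearrangement_antimono)
  also have "\<dots> = (\<integral>\<^sup>+ s. ?r s * indicator {0..t'} s \<partial>lebesgue) + ?r t' * ennreal t"
    using assms(2) by (subst nn_integral_add) (measurable, simp add: nn_integral_cmult_indicator)
  also have "(\<integral>\<^sup>+ s. ?r s * indicator {0..t'} s \<partial>lebesgue) = rearrangement_integral \<alpha> x t'"
    unfolding rearrangement_integral_def by (subst nn_integral_restrict_space) auto
  finally show ?thesis by (simp add: mult.commute)
qed

section \<open>Symmetric spaces on the unit interval\<close>

locale unit_symmetric_space = symmetric_space 1 E N for E N
begin

lemma mem_L0: "x \<in> E \<Longrightarrow> x \<in> L0 1"
  using subset_L0 by blast

lemma mem_rearrangement: "x \<in> E \<Longrightarrow> rearrangement 1 x \<in> E"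
  and norm_rearrangement: "x \<in> E \<Longrightarrow> N (rearrangement 1 x) = N x"
proof -
  have "rearrangement 1 x \<in> E \<and> N (rearrangement 1 x) = N x" if "x \<in> E" for x
    using that mem_L0 by (intro symmetric rearrangement_L0 distribution_rearrangement) auto
  then show "x \<in> E \<Longrightarrow> rearrangement 1 x \<in> E"
    "x \<in> E \<Longrightarrow> N (rearrangement 1 x) = N x" by auto
qed

text \<open>Smaller distributions give a pointwise smaller rearrangement, to which
  \<open>ideal\<close> applies; symmetry then passes from the rearrangements back to
  \<open>x\<close> and \<open>y\<close>.\<close>

lemma distribution_le_imp:
  assumes "x \<in> L0 1" "y \<in> E" "\<And>l. 0 \<le> l \<Longrightarrow> distribution 1 x l \<le> distribution 1 y l"
  shows "x \<in> E \<and> N x \<le> N y"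
proof -
  have "\<bar>rearrangement 1 x t\<bar> \<le> \<bar>rearrangement 1 y t\<bar>" for t
    using rearrangement_mono[of 1 x y t] assms(3) by (simp add: rearrangement_nonneg)
  then have *: "rearrangement 1 x \<in> E \<and> N (rearrangement 1 x) \<le> N (rearrangement 1 y)"
    using assms by (intro ideal rearrangement_L0 mem_rearrangement) auto
  then have "x \<in> E \<and> N x = N (rearrangement 1 x)"
    using assms(1) by (intro symmetric) (auto simp: distribution_rearrangement)
  with * show ?thesis using norm_rearrangement[OF assms(2)] by simp
qed

lemma AE_eq_imp:
  assumes "x \<in> L0 1" "y \<in> E" "AE t in leb 1. x t = y t"
  shows "x \<in> E \<and> N x = N y"
  using assms by (intro symmetric distribution_cong_AE) (auto intro: mem_L0)

lemma mem_abs: "x \<in> E \<Longrightarrow> (\<lambda>t. \<bar>x t\<bar>) \<in> E"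
  and norm_abs: "x \<in> E \<Longrightarrow> N (\<lambda>t. \<bar>x t\<bar>) = N x"
proof -
  have "(\<lambda>t. \<bar>x t\<bar>) \<in> E \<and> N (\<lambda>t. \<bar>x t\<bar>) = N x" if "x \<in> E" for x
  proof (rule symmetric)
    show "(\<lambda>t. \<bar>x t\<bar>) \<in> L0 1"
      using mem_L0[OF that] by (simp add: L0_def)
  qed (use that in \<open>simp_all add: distribution_def\<close>)
  then show "x \<in> E \<Longrightarrow> (\<lambda>t. \<bar>x t\<bar>) \<in> E"
    "x \<in> E \<Longrightarrow> N (\<lambda>t. \<bar>x t\<bar>) = N x" by auto
qed

lemma diff_closed:
  assumes "x \<in> E" "y \<in> E"
  shows "(\<lambda>t. x t - y t) \<in> E"
proof -
  have "(\<lambda>t. x t + ereal (- 1) * y t) \<in> E"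
    by (intro add_closed scale_closed assms)
  moreover have "u + ereal (- 1) * v = u - v" for u v :: ereal
    by (cases u; cases v) auto
  ultimately show ?thesis by simp
qed

text \<open>An infinite value at \<open>t\<close> would be taken on all of \<open>[0,t)\<close>,
  although members of \<open>E\<close> are finite almost everywhere.\<close>

lemma rearrangement_finite:
  assumes "x \<in> E" "0 < t"
  shows "rearrangement 1 x t < \<infinity>"
proof (rule ccontr)
  assume "\<not> rearrangement 1 x t < \<infinity>"
  then have inf: "rearrangement 1 x t = \<infinity>" by simp
  then have "t < 1"
    using rearrangement_eq_0[of t x] mem_L0[OF assms(1)] by (cases "t < 1") auto
  have "AE s in leb 1. \<bar>rearrangement 1 x s\<bar> \<noteq> \<infinity>"
    by (intro finite_ae mem_rearrangement assms)
  then have "AE s in leb 1. s \<notin> {0..<t}"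
  proof eventually_elim
    case (elim s)
    then show ?case
      using rearrangement_antimono[of s t 1 x] inf by auto
  qed
  moreover have "{0..<t} \<in> sets (leb 1)"
    using \<open>t < 1\<close> by (auto simp: sets_restrict_space image_iff interval_one intro!: bexI[of _ "{0..<t}"])
  ultimately have "emeasure (leb 1) {0..<t} = 0"
    using \<open>t < 1\<close> by (subst (asm) AE_iff_measurable[of "{0..<t}"]) (auto simp: interval_one)
  moreover have "emeasure (leb 1) {0..<t} = ennreal t"
    using \<open>t < 1\<close> \<open>0 < t\<close> by (subst emeasure_leb_one) auto
  ultimately show False using \<open>0 < t\<close> by simp
qed

lemma rearrangement_integral_eq_top:
  assumes "x \<in> E" "0 < t" "0 < t'" "rearrangement_integral 1 x t = \<infinity>"
  shows "rearrangement_integral 1 x t' = \<infinity>"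
proof -
  have "ennreal t * e2ennreal (rearrangement 1 x t') < \<infinity>"
    using rearrangement_finite[OF assms(1,3)] rearrangement_nonneg[of 1 x t']
    by (cases "rearrangement 1 x t'") (auto simp: e2ennreal_ereal ennreal_mult_less_top)
  moreover have "rearrangement_integral 1 x t' + ennreal t * e2ennreal (rearrangement 1 x t') = \<infinity>"
    using rearrangement_integral_le[OF mem_L0[OF assms(1)], of t t'] assms by (simp add: top_unique)
  ultimately show ?thesis by auto
qed

lemma rearrangement_of_norm_0:
  assumes "x \<in> E" "N x = 0"
  shows "rearrangement 1 x t = 0"
proof -
  have "(\<lambda>_. 0) \<in> L0 1" by (simp add: L0_def)
  moreover have "AE t in leb 1. x t = 0"
    using assms norm_eq_zero by blast
  ultimately have "rearrangement 1 x = rearrangement 1 (\<lambda>_. 0)"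
    using rearrangement_cong_AE[of x 1 "\<lambda>_. 0"] mem_L0[OF assms(1)] by simp
  moreover have "rearrangement 1 (\<lambda>_. 0) t = 0"
    using \<open>(\<lambda>_. 0) \<in> L0 1\<close>
    by (intro ereal_eqI) (auto simp: rearrangement_nonneg less_rearrangement_iff distribution_def)
  ultimately show ?thesis by simp
qed

lemma norm_eq_0_if_rearrangement_integral:
  assumes "x \<in> E" "rearrangement_integral 1 x 1 = 0"
  shows "N x = 0"
proof -
  have "AE s in lebesgue_on {0..1}. e2ennreal (rearrangement 1 x s) = 0"
    using assms(2) rearrangement_measurable(2)[OF mem_L0[OF assms(1)]]
    unfolding rearrangement_integral_def by (subst (asm) nn_integral_0_iff_AE) auto
  then have "AE s in lebesgue. s \<in> {0..1} \<longrightarrow> e2ennreal (rearrangement 1 x s) = 0"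
    by (subst (asm) AE_restrict_space_iff) auto
  then have "AE s in lebesgue. s \<in> interval 1 \<longrightarrow> rearrangement 1 x s = 0"
  proof eventually_elim
    case (elim s)
    then show ?case
      using enn2ereal_e2ennreal[OF rearrangement_nonneg[of 1 x s]]
      by (auto simp: interval_one zero_ennreal.rep_eq)
  qed
  then have "AE s in leb 1. rearrangement 1 x s = 0"
    by (simp add: AE_leb_one_iff interval_one)
  then show ?thesis
    using assms(1) mem_rearrangement norm_eq_zero norm_rearrangement by metis
qed

end

section \<open>Consequences of lower local uniform \<open>K\<close>-monotonicity\<close>

lemma indicator_L0:
  assumes "B \<in> sets lebesgue"
  shows "indicator B \<in> L0 \<alpha>"
  unfolding L0_def by (intro measurable_restrict_space1 borel_measurable_indicator assms)

lemma distribution_indicator: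
  assumes "B \<subseteq> {0..<1}" "0 \<le> l"
  shows "distribution 1 (indicator B) l = (if l < 1 then emeasure lebesgue B else 0)"
proof -
  have "{s \<in> interval 1. ereal l < \<bar>indicator B s\<bar>} = (if l < 1 then B else {})"
    using assms by (auto simp: interval_one indicator_def)
  then show ?thesis
    using emeasure_leb_one[OF assms(1)] by (simp add: distribution_def)
qed

context unit_symmetric_space
begin

text \<open>A strictly positive \<open>w\<close> exceeds some \<open>c > 0\<close> on a set of
  measure above 1/2. By symmetry \<open>w / c\<close> then dominates, in distribution, the indicator
  of every set of measure 1/2, and two such indicators add up to 1 on the interval.\<close>

lemma one_mem: "(\<lambda>_. 1) \<in> E"
proof -
  obtain w where w: "w \<in> E" "AE t in leb 1. 0 < w t"
    using strictly_positive by blast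
  have "distribution 1 w 0 = emeasure (leb 1) (space (leb 1))"
    unfolding distribution_def
  proof (rule emeasure_eq_AE)
    show "AE s in leb 1. s \<in> {s \<in> interval 1. ereal 0 < \<bar>w s\<bar>} \<longleftrightarrow> s \<in> space (leb 1)"
      using w(2) AE_space by eventually_elim (auto simp flip: zero_ereal_def)
  qed (use distribution_sets[OF mem_L0[OF w(1)], of 0] in simp_all)
  also have "\<dots> = 1"
    by (simp add: interval_one emeasure_restrict_space)
  finally have "ennreal (1 / 2) < distribution 1 w 0"
    by (simp only: ennreal_less_one_iff)
  then obtain c where c: "0 < c" "ennreal (1 / 2) < distribution 1 w c"
    using distribution_right_continuous[OF mem_L0[OF w(1)]] by blast
  have half: "indicator B \<in> E"
    if B: "B \<in> sets lebesgue" "B \<subseteq> {0..<1}" "emeasure lebesgue B = ennreal (1 / 2)" for B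
  proof -
    have "distribution 1 (indicator B) l \<le> distribution 1 (\<lambda>t. ereal (1 / c) * w t) l"
      if "0 \<le> l" for l
    proof (cases "l < 1")
      case True
      then have "distribution 1 w c \<le> distribution 1 w (l * c)"
        using c(1) by (intro distribution_antimono mem_L0 w) simp
      with True c that B show ?thesis
        by (simp add: distribution_indicator distribution_scale)
    qed (use that B in \<open>simp add: distribution_indicator\<close>)
    then show ?thesis
      using distribution_le_imp[OF indicator_L0[OF B(1)] scale_closed[OF w(1)]] by blast
  qed
  have "(\<lambda>t. indicator {0..<1/2} t + indicator {1/2..<1} t) \<in> E"
    by (intro add_closed half) auto
  then have "(\<lambda>_. 1) \<in> E \<and> N (\<lambda>_. 1) \<le> N (\<lambda>t. indicator {0..<1/2} t + indicator {1/2..<1} t)"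
    by (rule ideal[rotated]) (auto simp: L0_def AE_leb_one_iff indicator_def)
  then show ?thesis ..
qed

lemma const_mem: "(\<lambda>_. ereal c) \<in> E"
  and norm_const: "N (\<lambda>_. ereal c) = \<bar>c\<bar> * N (\<lambda>_. 1)"
  using scale_closed[OF one_mem, of c] norm_scale[OF one_mem, of c] by simp_all

lemma norm_one_pos: "0 < N (\<lambda>_. 1)"
proof -
  have "N (\<lambda>_. 1) \<noteq> 0"
  proof
    assume "N (\<lambda>_. 1) = 0"
    then have "AE t in lebesgue. t \<notin> {0..<1 :: real}"
      using norm_eq_zero[OF one_mem] by (simp add: AE_leb_one_iff)
    then have "{0..<1 :: real} \<in> null_sets lebesgue"
      by (subst AE_iff_null_sets) auto
    then show False by (simp add: null_sets_def)
  qed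
  then show ?thesis
    using norm_nonneg[OF one_mem] by simp
qed

lemma indicator_mem:
  assumes "B \<in> sets lebesgue"
  shows "indicator B \<in> E"
proof -
  have "AE t in leb 1. \<bar>indicator B t\<bar> \<le> \<bar>1 :: ereal\<bar>"
    by (auto simp: indicator_def)
  with ideal[OF indicator_L0[OF assms] one_mem] show ?thesis by blast
qed

lemma norm_indicator_mono:
  assumes "A \<in> sets lebesgue" "B \<in> sets lebesgue" "A \<subseteq> {0..<1}" "B \<subseteq> {0..<1}"
    "emeasure lebesgue A \<le> emeasure lebesgue B"
  shows "N (indicator A) \<le> N (indicator B)"
  using assms
  by (intro distribution_le_imp[THEN conjunct2] indicator_L0 indicator_mem)
    (auto simp: distribution_indicator)

section \<open>Strict K-monotonicity from lower local uniform K-monotonicity\<close>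

lemma rearrangement_eq_if_norm_eq:
  assumes "lower_locally_uniformly_K_monotone 1 E N"
    and "x \<in> E" "y \<in> E" "submajorized 1 y x" "N y = N x"
  shows "rearrangement 1 y = rearrangement 1 x"
proof -
  let ?z = "\<lambda>t. rearrangement 1 x t - rearrangement 1 y t"
  have "(\<lambda>n :: nat. N ?z) \<longlonglongrightarrow> 0"
    using assms(1)[unfolded lower_locally_uniformly_K_monotone_def, rule_format, of x "\<lambda>_. y"]
      assms(2-5) by simp
  then have "N ?z = 0"
    by (simp add: LIMSEQ_const_iff)
  then have "AE t in leb 1. ?z t = 0"
    using norm_eq_zero[of ?z] assms by (simp add: diff_closed mem_rearrangement)
  moreover have "AE t in leb 1. \<bar>rearrangement 1 x t\<bar> \<noteq> \<infinity>" "AE t in leb 1. \<bar>rearrangement 1 y t\<bar> \<noteq> \<infinity>"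
    using assms by (auto intro: finite_ae mem_rearrangement)
  ultimately have "AE t in leb 1. rearrangement 1 y t = rearrangement 1 x t"
  proof eventually_elim
    case (elim t)
    then show ?case by (cases "rearrangement 1 x t"; cases "rearrangement 1 y t") auto
  qed
  \<comment> \<open>Rearranging once more turns equality almost everywhere into equality
    everywhere.\<close>
  then have "rearrangement 1 (rearrangement 1 y) = rearrangement 1 (rearrangement 1 x)"
    using assms by (intro rearrangement_cong_AE rearrangement_L0 mem_L0)
  then show ?thesis
    using assms by (simp add: rearrangement_idem mem_L0)
qed

lemma strictly_K_monotone_if_lower_locally_uniformly:
  assumes L: "lower_locally_uniformly_K_monotone 1 E N"
  shows "strictly_K_monotone 1 E N"
  unfolding strictly_K_monotone_def
proof (intro ballI impI, elim conjE)
  fix x y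
  assume x: "x \<in> E" and y: "y \<in> E" and sub: "submajorized 1 y x"
    and neq: "\<exists>t\<in>interval 1. rearrangement 1 x t \<noteq> rearrangement 1 y t"
  show "N y < N x"
  proof (rule ccontr)
    assume "\<not> N y < N x"
    moreover have "N y \<noteq> N x"
      using rearrangement_eq_if_norm_eq[OF L x y sub] neq by auto
    ultimately have less: "N x < N y" by simp
    have R1: "rearrangement_integral 1 y 1 \<le> rearrangement_integral 1 x 1"
      using sub by (simp add: submajorized_iff)
    \<comment> \<open>The scaling below requires a positive factor. If \<open>N x\<close> were 0,
      the integrals of both rearrangements over \<open>[0,1]\<close> would vanish, and
      \<open>N y\<close> with them.\<close>
    have "N x \<noteq> 0"
    proof
      assume "N x = 0"
      then have "rearrangement_integral 1 x 1 = 0"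
        using rearrangement_of_norm_0[OF x] by (simp add: rearrangement_integral_def e2ennreal_neg)
      with R1 have "N y = 0"
        using norm_eq_0_if_rearrangement_integral[OF y] by simp
      with less norm_nonneg[OF x] show False by simp
    qed
    then have Nx: "0 < N x"
      using norm_nonneg[OF x] by simp
    \<comment> \<open>The factor gives \<open>y\<close> the norm of \<open>x\<close>, and being
      below 1 it preserves submajorization by \<open>x\<close>.\<close>
    define s where "s = N x / N y"
    have s: "0 < s" "s < 1"
      using less Nx by (simp_all add: s_def)
    let ?z = "\<lambda>t. ereal s * y t"
    have z: "?z \<in> E" "N ?z = N x"
      using norm_scale[OF y, of s] scale_closed[OF y] s less Nx by (simp_all add: s_def)
    have Rz: "rearrangement_integral 1 ?z t = ennreal s * rearrangement_integral 1 y t" for t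
      using s by (simp add: rearrangement_integral_scale mem_L0 y)
    have "submajorized 1 ?z x"
      unfolding submajorized_iff Rz
    proof (intro allI impI)
      fix t :: real assume "0 < t"
      have "ennreal s * rearrangement_integral 1 y t \<le> 1 * rearrangement_integral 1 y t"
        using s by (intro mult_right_mono) auto
      also have "\<dots> \<le> rearrangement_integral 1 x t"
        using sub \<open>0 < t\<close> by (simp add: submajorized_iff)
      finally show "ennreal s * rearrangement_integral 1 y t \<le> rearrangement_integral 1 x t" .
    qed
    then have eq: "rearrangement_integral 1 x 1 = ennreal s * rearrangement_integral 1 y 1"
      using rearrangement_eq_if_norm_eq[OF L x z(1) _ z(2)] Rz
      by (simp add: rearrangement_integral_def)
    show False
    proof (cases "rearrangement_integral 1 x 1")
      case (real r)
      with R1 obtain q where q: "rearrangement_integral 1 y 1 = ennreal q" "0 \<le> q"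
        by (cases "rearrangement_integral 1 y 1") (auto simp: top_unique)
      \<comment> \<open>\<open>R1\<close> bounds \<open>q\<close> by \<open>r\<close>, while the
        scaled function has the same integral as \<open>x\<close>; as \<open>s < 1\<close>, only
        \<open>q = 0\<close> remains.\<close>
      with R1 real eq s have "q \<le> r" "r = s * q"
        by (auto simp: ennreal_mult[symmetric])
      then have "(1 - s) * q \<le> 0" by (simp add: algebra_simps)
      with s q(2) have "q = 0" by (simp add: mult_le_0_iff)
      with \<open>r = s * q\<close> real have "N x = 0"
        using norm_eq_0_if_rearrangement_integral[OF x] by simp
      with Nx show False by simp
    next
      \<comment> \<open>Here \<open>x\<^sup>*\<^sup>* = \<infinity>\<close>, so \<open>x\<close> submajorizes everything, in particular a constant of the same norm.\<close>
      case top
      then have Rx: "rearrangement_integral 1 x t = \<infinity>" if "0 < t" for t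
        using rearrangement_integral_eq_top[OF x _ that, of 1] by simp
      define c where "c = N x / N (\<lambda>_. 1)"
      have "0 < c" using Nx norm_one_pos by (simp add: c_def)
      have c: "N (\<lambda>_. ereal c) = N x"
        using norm_const[of c] norm_one_pos Nx by (simp add: c_def)
      have "rearrangement 1 (\<lambda>_. ereal c) t \<le> ereal c" for t
        unfolding rearrangement_def
        by (rule Inf_lower) (use \<open>0 < c\<close> in \<open>auto simp: distribution_def\<close>)
      then have le_c: "e2ennreal (rearrangement 1 (\<lambda>_. ereal c) t) \<le> ennreal c" for t
        using e2ennreal_mono[of _ "ereal c"] by simp
      have "rearrangement_integral 1 (\<lambda>_. ereal c) 1 \<le> (\<integral>\<^sup>+ s. ennreal c \<partial>(lebesgue_on {0..1 :: real}))"
        unfolding rearrangement_integral_def by (intro nn_integral_mono le_c)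
      also have "\<dots> < \<infinity>"
        by (simp add: emeasure_restrict_space ennreal_mult_less_top)
      finally have "rearrangement_integral 1 (\<lambda>_. ereal c) 1 < \<infinity>" .
      moreover have "submajorized 1 (\<lambda>_. ereal c) x"
        using Rx by (simp add: submajorized_iff)
      then have "rearrangement 1 (\<lambda>_. ereal c) = rearrangement 1 x"
        using rearrangement_eq_if_norm_eq[OF L x const_mem _ c] by blast
      ultimately show False
        using Rx[of 1] by (simp add: rearrangement_integral_def)
    qed
  qed
qed

section \<open>Order continuity from lower local uniform K-monotonicity\<close>

lemma norm_truncation_tendsto:
  assumes L: "lower_locally_uniformly_K_monotone 1 E N" and F: "fatou_property 1 E N"
    and x: "x \<in> E"
  shows "(\<lambda>m :: nat. N (\<lambda>t. max (\<bar>x t\<bar> - ereal m) 0)) \<longlonglongrightarrow> 0"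
proof -
  \<comment> \<open>The truncations increase to \<open>\<bar>x\<bar>\<close>, so their norms
    converge to \<open>N x\<close> by the Fatou property, and they are submajorized by
    \<open>x\<close>. They thus form an admissible sequence for the hypothesis
    \<open>L\<close>.\<close>
  define u where "u = (\<lambda>m t. min \<bar>x t\<bar> (ereal (real m)))"
  have xL: "x \<in> L0 1" by (rule mem_L0[OF x])
  have uL: "u m \<in> L0 1" for m
    using xL by (simp add: L0_def u_def)
  have u_abs: "\<bar>u m t\<bar> = u m t" for m t
    by (simp add: u_def min_def)
  have u: "u m \<in> E" for m
    by (rule ideal[OF uL x, THEN conjunct1]) (simp add: u_abs, simp add: u_def)
  have "(\<lambda>m. u m t) \<longlonglongrightarrow> \<bar>x t\<bar>" for t
  proof (cases "\<bar>x t\<bar>")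
    case (real r)
    have "eventually (\<lambda>m. u m t = \<bar>x t\<bar>) sequentially"
      using eventually_ge_at_top[of "nat \<lceil>r\<rceil>"]
    proof eventually_elim
      case (elim m)
      then have "r \<le> real m" by linarith
      then show ?case by (simp add: u_def real)
    qed
    then show ?thesis by (rule tendsto_eventually)
  next
    case PInf
    then have "u m t = ereal (real m)" for m by (simp add: u_def)
    then show ?thesis using PInf by (simp add: id_nat_ereal_tendsto_PInf)
  next
    case MInf
    then show ?thesis by (cases "x t") auto
  qed
  moreover have "incseq (\<lambda>m. u m t)" for t
    by (rule incseq_SucI) (auto simp: u_def min_le_iff_disj min.coboundedI2)
  moreover have "N (u m) \<le> N x" for m
    by (rule ideal[OF uL x, THEN conjunct2]) (simp add: u_abs, simp add: u_def)
  ultimately have Nu: "(\<lambda>m. N (u m)) \<longlonglongrightarrow> N (\<lambda>t. \<bar>x t\<bar>)"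
    using F[unfolded fatou_property_def, rule_format, of "\<lambda>t. \<bar>x t\<bar>" u] u mem_abs[OF x] mem_L0
    by (auto simp: pos_cone_def bdd_above_def u_def)
  have du: "distribution 1 (u m) l = (if l < real m then distribution 1 x l else 0)" for m l
  proof -
    have "{s \<in> interval 1. ereal l < \<bar>u m s\<bar>} =
        (if l < real m then {s \<in> interval 1. ereal l < \<bar>x s\<bar>} else {})"
      unfolding u_abs by (auto simp: u_def)
    then show ?thesis by (simp add: distribution_def)
  qed
  \<comment> \<open>Truncation commutes with rearrangement: at levels below \<open>m\<close> the
    distributions of \<open>u m\<close> and \<open>x\<close> agree, and from \<open>m\<close> on
    that of \<open>u m\<close> is 0.\<close>
  have ru: "rearrangement 1 (u m) t = min (rearrangement 1 x t) (ereal m)" for m t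
  proof (rule ereal_eqI)
    fix l :: real assume "0 \<le> l"
    then show "ereal l < rearrangement 1 (u m) t \<longleftrightarrow> ereal l < min (rearrangement 1 x t) (ereal m)"
      using less_rearrangement_iff[OF uL] less_rearrangement_iff[OF xL] by (simp add: du)
  qed (simp_all add: rearrangement_nonneg)
  have "submajorized 1 (u m) x" for m
    unfolding submajorized_iff rearrangement_integral_def ru
    by (intro allI impI nn_integral_mono e2ennreal_mono) simp
  then have lim: "(\<lambda>m. N (\<lambda>t. rearrangement 1 x t - rearrangement 1 (u m) t)) \<longlonglongrightarrow> 0"
    using L[unfolded lower_locally_uniformly_K_monotone_def, rule_format, of x u] x u Nu
    by (simp add: norm_abs)
  show ?thesis
  proof (rule tendsto_sandwich[OF _ _ tendsto_const lim])
    \<comment> \<open>At level \<open>l\<close> both functions have the distribution of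
      \<open>x\<close> at level \<open>m + l\<close>, so \<open>distribution_le_imp\<close> compares
      their norms.\<close>
    have *: "(\<lambda>t. max (\<bar>x t\<bar> - ereal m) 0) \<in> E \<and>
        N (\<lambda>t. max (\<bar>x t\<bar> - ereal m) 0) \<le> N (\<lambda>t. rearrangement 1 x t - rearrangement 1 (u m) t)"
      for m
    proof (rule distribution_le_imp)
      show "(\<lambda>t. max (\<bar>x t\<bar> - ereal m) 0) \<in> L0 1"
        using xL by (simp add: L0_def)
      show "(\<lambda>t. rearrangement 1 x t - rearrangement 1 (u m) t) \<in> E"
        by (intro diff_closed mem_rearrangement x u)
      fix l :: real assume l: "0 \<le> l"
      have "{s \<in> interval 1. ereal l < \<bar>max (\<bar>x s\<bar> - ereal m) 0\<bar>} =
          {s \<in> interval 1. ereal (m + l) < \<bar>x s\<bar>}"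
      proof -
        have "ereal l < \<bar>max (\<bar>x s\<bar> - ereal m) 0\<bar> \<longleftrightarrow> ereal (m + l) < \<bar>x s\<bar>" for s
          using l by (cases "x s") (auto simp: max_def)
        then show ?thesis by simp
      qed
      then have "distribution 1 (\<lambda>t. max (\<bar>x t\<bar> - ereal m) 0) l = distribution 1 x (m + l)"
        by (simp add: distribution_def)
      also have "\<dots> = distribution 1 (rearrangement 1 x) (m + l)"
        using l by (simp add: distribution_rearrangement xL)
      also have "\<dots> = distribution 1 (\<lambda>t. rearrangement 1 x t - rearrangement 1 (u m) t) l"
      proof -
        have "ereal (m + l) < \<bar>rearrangement 1 x s\<bar> \<longleftrightarrow>
            ereal l < \<bar>rearrangement 1 x s - rearrangement 1 (u m) s\<bar>" for s
          using l rearrangement_nonneg[of 1 x s] unfolding ru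
          by (cases "rearrangement 1 x s") (auto simp: min_def)
        then show ?thesis by (simp add: distribution_def)
      qed
      finally show "distribution 1 (\<lambda>t. max (\<bar>x t\<bar> - ereal m) 0) l \<le>
          distribution 1 (\<lambda>t. rearrangement 1 x t - rearrangement 1 (u m) t) l" by simp
    qed
    show "\<forall>\<^sub>F m in sequentially. 0 \<le> N (\<lambda>t. max (\<bar>x t\<bar> - ereal (real m)) 0)"
      using * norm_nonneg by simp
    show "\<forall>\<^sub>F m in sequentially. N (\<lambda>t. max (\<bar>x t\<bar> - ereal (real m)) 0) \<le>
        N (\<lambda>t. rearrangement 1 x t - rearrangement 1 (u m) t)"
      using * by simp
  qed
qed

text \<open>The norm of an indicator depends only on the measure of the set, so small end intervals
  \<open>[1 - d k, 1)\<close> suffice. Rearranging moves \<open>v k\<close> from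
  \<open>[d k, 1)\<close> to \<open>[0, 1 - d k)\<close>, and the difference from the rearrangement
  of 1 is the indicator of such an end interval.\<close>

lemma norm_indicator_tendsto:
  assumes L: "lower_locally_uniformly_K_monotone 1 E N" and F: "fatou_property 1 E N"
    and B: "\<And>n. B n \<in> sets lebesgue" "\<And>n. B n \<subseteq> {0..<1}"
    and lim: "(\<lambda>n :: nat. emeasure lebesgue (B n)) \<longlonglongrightarrow> 0"
  shows "(\<lambda>n. N (indicator (B n))) \<longlonglongrightarrow> 0"
proof -
  define d where "d k = 1 / real (Suc k)" for k
  have d: "0 < d k" "d k \<le> 1" "d (Suc k) \<le> d k" for k
    by (simp_all add: d_def field_simps)
  define v :: "nat \<Rightarrow> real \<Rightarrow> ereal" where "v k = indicator {d k..<1}" for k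
  have v: "v k \<in> E" for k
    unfolding v_def by (rule indicator_mem) simp
  have "d \<longlonglongrightarrow> 0"
    unfolding d_def by (rule LIMSEQ_Suc[OF lim_1_over_n])
  have AEv: "AE t in leb 1. incseq (\<lambda>k. v k t) \<and> (\<lambda>k. v k t) \<longlonglongrightarrow> 1"
  proof -
    \<comment> \<open>Every \<open>v k\<close> vanishes at 0, so convergence to 1 fails at that
      point.\<close>
    have "AE t in lebesgue. t \<noteq> (0 :: real)"
      by (rule AE_completion) (rule AE_lborel_singleton)
    then have "AE t in lebesgue. t \<in> {0..<1} \<longrightarrow> incseq (\<lambda>k. v k t) \<and> (\<lambda>k. v k t) \<longlonglongrightarrow> 1"
    proof eventually_elim
      case (elim t)
      show ?case
      proof (intro impI conjI)
        assume t: "t \<in> {0..<1}"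
        show "incseq (\<lambda>k. v k t)"
          by (rule incseq_SucI) (use d(3) in \<open>auto simp: v_def indicator_def intro: order_trans\<close>)
        have "eventually (\<lambda>k. d k < t) sequentially"
          using order_tendstoD(2)[OF \<open>d \<longlonglongrightarrow> 0\<close>, of t] t elim by auto
        then have "eventually (\<lambda>k. v k t = 1) sequentially"
          by eventually_elim (use t in \<open>simp add: v_def\<close>)
        then show "(\<lambda>k. v k t) \<longlonglongrightarrow> 1" by (rule tendsto_eventually)
      qed
    qed
    then show ?thesis by (simp only: AE_leb_one_iff)
  qed
  have "N (v k) \<le> N (\<lambda>_. 1)" for k
    by (rule ideal[OF mem_L0[OF v] one_mem, THEN conjunct2]) (simp add: v_def indicator_def)
  then have Nv: "(\<lambda>k. N (v k)) \<longlonglongrightarrow> N (\<lambda>_. 1)"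
    using F[unfolded fatou_property_def, rule_format, of "\<lambda>_. 1" v] v AEv mem_L0[OF one_mem]
    by (auto simp: pos_cone_def bdd_above_def v_def)
  \<comment> \<open>Negative arguments are excluded because \<open>ennreal t\<close> is then 0, and
    the rearrangement repeats its value at 0.\<close>
  have r1: "rearrangement 1 (\<lambda>_. 1) t = indicator {0..<1} t" if "0 \<le> t" for t
  proof (rule ereal_eqI)
    fix l :: real assume l: "0 \<le> l"
    have "{s \<in> interval 1. ereal l < \<bar>1\<bar>} = (if l < 1 then {0..<1} else {})"
      by (auto simp: interval_one)
    then have "distribution 1 (\<lambda>_. 1) l = (if l < 1 then 1 else 0)"
      by (simp add: distribution_def interval_one emeasure_restrict_space)
    then show "ereal l < rearrangement 1 (\<lambda>_. 1) t \<longleftrightarrow> ereal l < indicator {0..<1} t"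
      using l that less_rearrangement_iff[OF mem_L0[OF one_mem] l, of t]
      by (auto simp: indicator_def)
  qed (simp_all add: rearrangement_nonneg)
  have rv: "rearrangement 1 (v k) t = indicator {0..<1 - d k} t" if "0 \<le> t" for k t
  proof (rule ereal_eqI)
    fix l :: real assume l: "0 \<le> l"
    have "distribution 1 (v k) l = (if l < 1 then ennreal (1 - d k) else 0)"
      unfolding v_def using d[of k] l by (subst distribution_indicator) auto
    then show "ereal l < rearrangement 1 (v k) t \<longleftrightarrow> ereal l < indicator {0..<1 - d k} t"
      using l that d[of k] less_rearrangement_iff[OF mem_L0[OF v] l, where t = t]
      by (auto simp: indicator_def ennreal_less_iff)
  qed (simp_all add: rearrangement_nonneg)
  have "submajorized 1 (v k) (\<lambda>_. 1)" for k
    unfolding submajorized_iff rearrangement_integral_def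
    by (intro allI impI nn_integral_mono e2ennreal_mono) (use d(1)[of k] in \<open>simp add: r1 rv indicator_def\<close>)
  then have lim1: "(\<lambda>k. N (\<lambda>t. rearrangement 1 (\<lambda>_. 1) t - rearrangement 1 (v k) t)) \<longlonglongrightarrow> 0"
    using L[unfolded lower_locally_uniformly_K_monotone_def, rule_format, of "\<lambda>_. 1" v] one_mem v Nv
    by simp
  have b: "N (\<lambda>t. rearrangement 1 (\<lambda>_. 1) t - rearrangement 1 (v k) t) = N (indicator {1 - d k..<1})"
    for k
  proof -
    have "AE t in leb 1. rearrangement 1 (\<lambda>_. 1) t - rearrangement 1 (v k) t = indicator {1 - d k..<1} t"
      using d[of k] by (auto simp: AE_leb_one_iff r1 rv indicator_def)
    then show ?thesis
      by (intro AE_eq_imp[THEN conjunct2] mem_L0 diff_closed mem_rearrangement one_mem v indicator_mem)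
        auto
  qed
  show ?thesis
  proof (rule LIMSEQ_I)
    fix e :: real assume "0 < e"
    have "eventually (\<lambda>k. N (indicator {1 - d k..<1}) < e) sequentially"
      using order_tendstoD(2)[OF lim1 \<open>0 < e\<close>] by (simp add: b)
    then obtain k where k: "N (indicator {1 - d k..<1}) < e"
      by (auto simp: eventually_sequentially)
    have "eventually (\<lambda>n. emeasure lebesgue (B n) < ennreal (d k)) sequentially"
      using order_tendstoD(2)[OF lim, of "ennreal (d k)"] d(1)[of k] by simp
    then obtain n0 where n0: "\<And>n. n \<ge> n0 \<Longrightarrow> emeasure lebesgue (B n) < ennreal (d k)"
      by (auto simp: eventually_sequentially)
    have "norm (N (indicator (B n)) - 0) < e" if "n \<ge> n0" for n
    proof -
      have "N (indicator (B n)) \<le> N (indicator {1 - d k..<1})"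
        using n0[OF that] d[of k] by (intro norm_indicator_mono B) auto
      with k norm_nonneg[OF indicator_mem[OF B(1)], of n] show ?thesis by simp
    qed
    then show "\<exists>n0. \<forall>n\<ge>n0. norm (N (indicator (B n)) - 0) < e" by blast
  qed
qed

text \<open>With \<open>B n\<close> the set where \<open>X n\<close> exceeds \<open>c\<close>,
  almost everywhere \<open>X n\<close> is at most
  \<open>max (\<bar>x\<bar> - m) 0 + c + m * indicator (B n)\<close>: on \<open>B n\<close> because
  \<open>X n\<close> is at most \<open>\<bar>x\<bar>\<close>, elsewhere because of \<open>c\<close>.
  First \<open>m\<close> and \<open>c\<close> are fixed to make two terms small, then
  \<open>n\<close> is taken large for the third.\<close>

lemma order_continuous_if_lower_locally_uniformly:
  assumes L: "lower_locally_uniformly_K_monotone 1 E N" and F: "fatou_property 1 E N"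
  shows "order_continuous 1 E N"
  unfolding order_continuous_def
proof (intro ballI allI impI, elim conjE)
  fix x X
  assume x: "x \<in> E"
    and X: "\<forall>n. X n \<in> pos_cone 1 E \<and> (AE t in leb 1. X n t \<le> \<bar>x t\<bar>)"
    and lim: "AE t in leb 1. (\<lambda>n. X n t) \<longlonglongrightarrow> 0"
  have XE: "X n \<in> E" and Xpos: "AE t in leb 1. 0 \<le> X n t" and Xle: "AE t in leb 1. X n t \<le> \<bar>x t\<bar>" for n
    using X by (auto simp: pos_cone_def)
  have xg: "(\<lambda>t. max (\<bar>x t\<bar> - ereal (real m)) 0) \<in> E" for m
  proof (rule ideal[OF _ x, THEN conjunct1])
    show "(\<lambda>t. max (\<bar>x t\<bar> - ereal (real m)) 0) \<in> L0 1"
      using mem_L0[OF x] by (simp add: L0_def)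
    have "\<bar>max (\<bar>u\<bar> - ereal (real m)) 0\<bar> \<le> \<bar>u\<bar>" for u
      by (cases u) (auto simp: max_def)
    then show "AE t in leb 1. \<bar>max (\<bar>x t\<bar> - ereal (real m)) 0\<bar> \<le> \<bar>x t\<bar>" by simp
  qed
  show "(\<lambda>n. N (X n)) \<longlonglongrightarrow> 0"
  proof (rule LIMSEQ_I)
    fix e :: real assume "0 < e"
    then obtain m :: nat where m: "N (\<lambda>t. max (\<bar>x t\<bar> - ereal m) 0) < e / 3"
      using order_tendstoD(2)[OF norm_truncation_tendsto[OF L F x], of "e / 3"]
      by (auto simp: eventually_sequentially)
    define c where "c = e / (3 * N (\<lambda>_. 1))"
    have c: "0 < c" "c * N (\<lambda>_. 1) = e / 3"
      using \<open>0 < e\<close> norm_one_pos by (simp_all add: c_def)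
    define B where "B n = {t \<in> interval 1. ereal c < \<bar>X n t\<bar>}" for n
    have Bleb: "B n \<in> sets (leb 1)" for n
      unfolding B_def by (intro distribution_sets mem_L0 XE)
    have B: "B n \<in> sets lebesgue" "B n \<subseteq> {0..<1}" for n
      using Bleb[of n] by (simp_all add: interval_one sets_restrict_space_iff)
    \<comment> \<open>The interval has finite measure, so almost everywhere convergence implies
      convergence in measure; here this comes from dominated convergence with bound 1.\<close>
    have "(\<lambda>n. integral\<^sup>N (leb 1) (indicator (B n))) \<longlonglongrightarrow> integral\<^sup>N (leb 1) (\<lambda>_. 0)"
    proof (rule nn_integral_dominated_convergence[where w = "\<lambda>_. 1"])
      show "(\<integral>\<^sup>+ t. 1 \<partial>leb 1) < \<infinity>"
        by (simp add: interval_one emeasure_restrict_space)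
      show "AE t in leb 1. (\<lambda>n. indicator (B n) t :: ennreal) \<longlonglongrightarrow> 0"
        using lim
      proof eventually_elim
        case (elim t)
        have "(\<lambda>n. \<bar>X n t\<bar>) \<longlonglongrightarrow> \<bar>0\<bar>"
          using elim by (rule tendsto_abs_ereal)
        then have "eventually (\<lambda>n. \<bar>X n t\<bar> < ereal c) sequentially"
          using order_tendstoD(2)[of _ "0::ereal" _ "ereal c"] c(1) by simp
        then have "eventually (\<lambda>n. indicator (B n) t = (0 :: ennreal)) sequentially"
          by eventually_elim (auto simp: B_def indicator_def dest: less_asym)
        then show ?case by (rule tendsto_eventually)
      qed
    qed (use Bleb in \<open>auto simp: indicator_def\<close>)
    then have "(\<lambda>n. emeasure lebesgue (B n)) \<longlonglongrightarrow> 0"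
      using Bleb emeasure_leb_one[OF B(2)] by simp
    then have "(\<lambda>n. N (indicator (B n))) \<longlonglongrightarrow> 0"
      by (rule norm_indicator_tendsto[OF L F B])
    then have limB: "(\<lambda>n. real m * N (indicator (B n))) \<longlonglongrightarrow> 0"
      by (rule tendsto_mult_right_zero)
    then obtain n0 where n0: "\<And>n. n \<ge> n0 \<Longrightarrow> real m * N (indicator (B n)) < e / 3"
      using order_tendstoD(2)[OF limB, of "e / 3"] \<open>0 < e\<close> by (auto simp: eventually_sequentially)
    have "norm (N (X n) - 0) < e" if n: "n \<ge> n0" for n
    proof -
      let ?g = "\<lambda>t. max (\<bar>x t\<bar> - ereal m) 0" and ?b = "\<lambda>t. ereal m * indicator (B n) t"
      have gE: "(\<lambda>t. ?g t + ereal c) \<in> E" and bE: "?b \<in> E"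
        using xg const_mem add_closed scale_closed indicator_mem[OF B(1)] by auto
      have "AE t in leb 1. \<bar>X n t\<bar> \<le> \<bar>?g t + ereal c + ?b t\<bar>"
        using Xpos[of n] Xle[of n] AE_space
      proof eventually_elim
        case (elim t)
        show ?case
        proof (cases "t \<in> B n")
          case True
          then show ?thesis
            using elim c(1) by (cases "x t"; cases "X n t") (auto simp: max_def)
        next
          case False
          then have "\<bar>X n t\<bar> \<le> ereal c"
            using elim by (auto simp: B_def)
          also have "ereal c \<le> \<bar>?g t + ereal c + ?b t\<bar>"
            using False c(1) by (cases "x t") (auto simp: max_def)
          finally show ?thesis .
        qed
      qed
      then have "N (X n) \<le> N (\<lambda>t. ?g t + ereal c + ?b t)"
        using ideal[OF mem_L0[OF XE] add_closed[OF gE bE]] by blast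
      also have "\<dots> \<le> N (\<lambda>t. ?g t + ereal c) + N ?b"
        by (rule norm_triangle[OF gE bE])
      also have "N (\<lambda>t. ?g t + ereal c) \<le> N ?g + N (\<lambda>_. ereal c)"
        by (rule norm_triangle[OF xg const_mem])
      also have "N ?b = real m * N (indicator (B n))"
        by (subst norm_scale) (simp_all add: indicator_mem B)
      finally have "N (X n) < e"
        using m c n0[OF n] norm_const[of c] by simp
      then show ?thesis using norm_nonneg[OF XE] by simp
    qed
    then show "\<exists>n0. \<forall>n\<ge>n0. norm (N (X n) - 0) < e" by blast
  qed
qed

end

section \<open>Strict \<open>K\<close>-monotonicity and order continuity\<close>

lemma Helly_antimono_ereal:
  fixes f :: "nat \<Rightarrow> real \<Rightarrow> ereal"
  assumes anti: "\<And>n. antimono (f n)"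
  obtains s where "strict_mono s"
    "countable {t. liminf (\<lambda>n. f (s n) t) < limsup (\<lambda>n. f (s n) t)}"
proof -
  define q where "q k = (of_rat (from_nat k) :: real)" for k :: nat
  interpret subseqs "\<lambda>k s. convergent (\<lambda>n. f (s n) (q k))"
  proof
    fix k and s :: "nat \<Rightarrow> nat"
    obtain l r where "strict_mono r" "((\<lambda>n. f (s n) (q k)) \<circ> r) \<longlonglongrightarrow> l"
      using compact_complete_linorder by blast
    then show "\<exists>r. strict_mono r \<and> convergent (\<lambda>n. f ((s \<circ> r) n) (q k))"
      by (auto simp: convergent_def comp_def)
  qed
  have conv: "convergent (\<lambda>n. f (diagseq n) (q k))" for k
  proof -
    \<comment> \<open>Only from index \<open>Suc k\<close> on is the diagonal known to be a
      subsequence of the one chosen at stage \<open>k\<close>; the shift does not affect the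
      limit.\<close>
    have "convergent (\<lambda>n. f ((diagseq \<circ> (+) (Suc k)) n) (q k))"
    proof (rule diagseq_holds)
      fix r s :: "nat \<Rightarrow> nat" and n
      assume "strict_mono r" "convergent (\<lambda>m. f (s m) (q n))"
      then show "convergent (\<lambda>m. f ((s \<circ> r) m) (q n))"
        using convergent_subseq_convergent[of "\<lambda>m. f (s m) (q n)" r] by (simp add: comp_def)
    qed
    then obtain l where "(\<lambda>n. f (diagseq (n + Suc k)) (q k)) \<longlonglongrightarrow> l"
      by (auto simp: convergent_def comp_def add.commute)
    then have "(\<lambda>n. f (diagseq n) (q k)) \<longlonglongrightarrow> l"
      by (rule LIMSEQ_offset)
    then show ?thesis by (auto simp: convergent_def)
  qed
  let ?l = "\<lambda>t. liminf (\<lambda>n. f (diagseq n) t)" and ?L = "\<lambda>t. limsup (\<lambda>n. f (diagseq n) t)"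
  let ?D = "{t. ?l t < ?L t}"
  have le: "?L t' \<le> ?l t" if "t < t'" for t t'
  proof -
    obtain r where r: "t < of_rat r" "of_rat r < t'"
      using of_rat_dense[OF \<open>t < t'\<close>] by auto
    define k where "k = to_nat r"
    have k: "q k = of_rat r" by (simp add: q_def k_def)
    have "?L t' \<le> ?L (q k)"
      using r k by (intro Limsup_mono always_eventually allI antimonoD[OF anti]) simp
    also have "?L (q k) = ?l (q k)"
    proof -
      obtain c where "(\<lambda>n. f (diagseq n) (q k)) \<longlonglongrightarrow> c"
        using conv[of k] by (auto simp: convergent_def)
      then show ?thesis
        using lim_imp_Liminf[OF sequentially_bot] lim_imp_Limsup[OF sequentially_bot] by metis
    qed
    also have "\<dots> \<le> ?l t"
      using r k by (intro Liminf_mono always_eventually allI antimonoD[OF anti]) simp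
    finally show ?thesis .
  qed
  have "\<exists>r :: rat. ?l t < ereal (of_rat r) \<and> ereal (of_rat r) < ?L t" if t: "t \<in> ?D" for t
  proof -
    obtain a where a: "?l t < ereal a" "ereal a < ?L t"
      using t ereal_dense2[of "?l t" "?L t"] by auto
    obtain b where b: "ereal a < ereal b" "ereal b < ?L t"
      using a ereal_dense2[of "ereal a" "?L t"] by auto
    obtain r :: rat where r: "a < of_rat r" "of_rat r < b"
      using b(1) of_rat_dense[of a b] by auto
    have "?l t < ereal (of_rat r)"
      using less_trans[OF a(1), of "ereal (of_rat r)"] r(1) by simp
    moreover have "ereal (of_rat r) < ?L t"
      using less_trans[OF _ b(2), of "ereal (of_rat r)"] r(2) by simp
    ultimately show ?thesis by blast
  qed
  then have "\<forall>t\<in>?D. \<exists>r :: rat. ?l t < ereal (of_rat r) \<and> ereal (of_rat r) < ?L t" by blast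
  from bchoice[OF this] obtain g :: "real \<Rightarrow> rat" where
    g: "\<And>t. t \<in> ?D \<Longrightarrow> ?l t < ereal (of_rat (g t)) \<and> ereal (of_rat (g t)) < ?L t"
    by blast
  have no_less: "\<not> t < t'" if "t \<in> ?D" "t' \<in> ?D" "g t = g t'" for t t'
  proof
    assume "t < t'"
    have "?L t' \<le> ?l t" by (rule le[OF \<open>t < t'\<close>])
    also have "?l t < ereal (of_rat (g t))" using g[OF that(1)] by simp
    also have "ereal (of_rat (g t)) < ?L t'" using g[OF that(2)] that(3) by simp
    finally show False .
  qed
  have "inj_on g ?D"
  proof (rule inj_onI)
    fix t t' assume "t \<in> ?D" "t' \<in> ?D" "g t = g t'"
    then have "\<not> t < t'" "\<not> t' < t"
      using no_less[of t t'] no_less[of t' t] by simp_all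
    then show "t = t'" by simp
  qed
  then have "countable ?D"
    using countable_image_inj_on countableI_type by blast
  with subseq_diagseq show ?thesis by (rule that)
qed

text \<open>Selection yields convergent subsequences only. If the whole sequence failed to converge
  to \<open>l\<close>, some subsequence would stay at distance at least \<open>e\<close> from
  \<open>l\<close>, and so would all its subsequences.\<close>

lemma LIMSEQ_if_subseq_LIMSEQ:
  fixes a :: "nat \<Rightarrow> 'a :: metric_space"
  assumes "\<And>r :: nat \<Rightarrow> nat. strict_mono r \<Longrightarrow>
      \<exists>s :: nat \<Rightarrow> nat. strict_mono s \<and> (\<lambda>n. a (r (s n))) \<longlonglongrightarrow> l"
  shows "a \<longlonglongrightarrow> l"
proof (rule ccontr)
  assume "\<not> a \<longlonglongrightarrow> l"
  then obtain e where e: "0 < e" "\<forall>n0. \<exists>n\<ge>n0. e \<le> dist (a n) l"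
    by (auto simp: lim_sequentially not_less)
  then have "infinite {n. e \<le> dist (a n) l}"
    by (auto simp: infinite_nat_iff_unbounded_le)
  then obtain r :: "nat \<Rightarrow> nat" where r: "strict_mono r" "\<And>n. e \<le> dist (a (r n)) l"
    using infinite_enumerate by force
  then obtain s where "(\<lambda>n. a (r (s n))) \<longlonglongrightarrow> l"
    using assms[OF r(1)] by blast
  with e(1) r(2) show False
    by (auto simp: lim_sequentially not_less[symmetric])
qed

section \<open>Uniform control of submajorized functions\<close>

context unit_symmetric_space
begin

text \<open>Rearrangements that agree on the interval have equal norms by symmetry; otherwise the
  strict inequality applies.\<close>

lemma K_monotone:
  assumes S: "strictly_K_monotone 1 E N"
    and x: "x \<in> E" and y: "y \<in> E" and sub: "submajorized 1 y x"
  shows "N y \<le> N x"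
proof (cases "\<exists>t\<in>interval 1. rearrangement 1 x t \<noteq> rearrangement 1 y t")
  case True
  then show ?thesis
    using S x y sub unfolding strictly_K_monotone_def by force
next
  case False
  then have "AE t in leb 1. rearrangement 1 y t = rearrangement 1 x t"
    by (auto simp: AE_leb_one_iff interval_one)
  then have "N (rearrangement 1 y) = N (rearrangement 1 x)"
    using AE_eq_imp[of "rearrangement 1 y" "rearrangement 1 x"] x y
    by (simp add: mem_rearrangement mem_L0)
  then show ?thesis using x y by (simp add: norm_rearrangement)
qed

text \<open>With one infinite integral all integrals over \<open>[0,t]\<close>,
  \<open>t > 0\<close>, are infinite. Then \<open>x\<close> submajorizes \<open>2 x\<close>, which
  forces \<open>N x = 0\<close> and a vanishing rearrangement.\<close>

lemma rearrangement_integral_finite: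
  assumes S: "strictly_K_monotone 1 E N" and x: "x \<in> E" and "0 < t"
  shows "rearrangement_integral 1 x t < \<infinity>"
proof (rule ccontr)
  assume "\<not> rearrangement_integral 1 x t < \<infinity>"
  then have top: "rearrangement_integral 1 x t = \<infinity>" by (simp add: less_top[symmetric])
  then have "submajorized 1 (\<lambda>t. ereal 2 * x t) x"
    using rearrangement_integral_eq_top[OF x \<open>0 < t\<close>] by (simp add: submajorized_iff)
  then have "2 * N x \<le> N x"
    using K_monotone[OF S x scale_closed[OF x, of 2]] norm_scale[OF x, of 2] by simp
  then have "N x = 0" using norm_nonneg[OF x] by simp
  then have "rearrangement_integral 1 x t = 0"
    using rearrangement_of_norm_0[OF x] by (simp add: rearrangement_integral_def e2ennreal_neg)
  with top show False by simp
qed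

text \<open>The Chebyshev bound gives \<open>C\<close> as the maximal function of \<open>x\<close>
  at \<open>t\<close>. One constant serves all \<open>z\<close>, so everything submajorized by
  \<open>x\<close> is uniformly bounded away from 0.\<close>

lemma submajorized_imp_rearrangement_bound:
  assumes S: "strictly_K_monotone 1 E N" and x: "x \<in> E" and "0 < t"
  obtains C where "\<And>z. z \<in> E \<Longrightarrow> submajorized 1 z x \<Longrightarrow> rearrangement 1 z t \<le> ereal C"
proof -
  obtain r where r: "rearrangement_integral 1 x t = ennreal r" "0 \<le> r"
    using rearrangement_integral_finite[OF assms]
    by (cases "rearrangement_integral 1 x t") auto
  have "rearrangement 1 z t \<le> ereal (r / t)" if z: "z \<in> E" "submajorized 1 z x" for z
  proof -
    obtain a where a: "rearrangement 1 z t = ereal a" "0 \<le> a"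
      using rearrangement_finite[OF z(1) \<open>0 < t\<close>] rearrangement_nonneg[of 1 z t]
      by (cases "rearrangement 1 z t") auto
    have "ennreal t * e2ennreal (rearrangement 1 z t) \<le> rearrangement_integral 1 z t"
      using \<open>0 < t\<close> by (intro rearrangement_integral_ge) simp
    also have "\<dots> \<le> ennreal r"
      using z(2) \<open>0 < t\<close> by (simp add: submajorized_iff flip: r(1))
    finally have "ennreal (t * a) \<le> ennreal r"
      using a \<open>0 < t\<close> by (simp add: ennreal_mult)
    then have "t * a \<le> r" using r(2) by (simp add: ennreal_le_iff)
    with a(1) \<open>0 < t\<close> show ?thesis by (simp add: field_simps)
  qed
  then show ?thesis by (rule that)
qed

lemma cut_mem:
  assumes "x \<in> E"
  shows "cut d x \<in> E"
proof -
  have "cut d x \<in> E \<and> N (cut d x) \<le> N x"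
    by (rule ideal[OF cut_L0[OF mem_L0[OF assms]] assms]) (auto simp: cut_def)
  then show ?thesis ..
qed

text \<open>The cuts are dominated by \<open>\<bar>x\<bar>\<close> and eventually vanish at each
  \<open>t > 0\<close>. Absolute values appear because order continuity concerns the positive
  cone.\<close>

lemma norm_cut_tendsto:
  assumes O: "order_continuous 1 E N" and x: "x \<in> E"
  shows "(\<lambda>k. N (cut (1 / real (Suc k)) x)) \<longlonglongrightarrow> 0"
proof -
  have lim: "(\<lambda>k. N (\<lambda>t. \<bar>cut (1 / real (Suc k)) x t\<bar>)) \<longlonglongrightarrow> 0"
  proof (rule O[unfolded order_continuous_def, rule_format, OF x,
        of "\<lambda>k t. \<bar>cut (1 / real (Suc k)) x t\<bar>"], intro conjI allI)
    show "(\<lambda>t. \<bar>cut (1 / real (Suc k)) x t\<bar>) \<in> pos_cone 1 E" for k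
      using mem_abs[OF cut_mem[OF x]] by (simp add: pos_cone_def)
    show "AE t in leb 1. \<bar>cut (1 / real (Suc k)) x t\<bar> \<le> \<bar>x t\<bar>" for k
      by (auto simp: cut_def)
    have "AE t in lebesgue. t \<noteq> (0 :: real)"
      by (rule AE_completion) (rule AE_lborel_singleton)
    then show "AE t in leb 1. (\<lambda>k. \<bar>cut (1 / real (Suc k)) x t\<bar>) \<longlonglongrightarrow> 0"
      unfolding AE_leb_one_iff
    proof eventually_elim
      case (elim t)
      show ?case
      proof
        assume "t \<in> {0..<1}"
        with elim have "0 < t" by simp
        then have "eventually (\<lambda>k. 1 / real (Suc k) < t) sequentially"
          using order_tendstoD(2)[OF LIMSEQ_Suc[OF lim_1_over_n]] by blast
        then have "eventually (\<lambda>k. \<bar>cut (1 / real (Suc k)) x t\<bar> = 0) sequentially"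
          by eventually_elim (simp add: cut_def)
        then show "(\<lambda>k. \<bar>cut (1 / real (Suc k)) x t\<bar>) \<longlonglongrightarrow> 0"
          by (rule tendsto_eventually)
      qed
    qed
  qed
  then show ?thesis by (simp add: norm_abs cut_mem x)
qed

section \<open>Norm convergence of a subsequence of rearrangements\<close>

lemma submajorized_convergent_subseq:
  assumes S: "strictly_K_monotone 1 E N" and O: "order_continuous 1 E N"
    and F: "fatou_property 1 E N"
    and x: "x \<in> E" and X: "\<And>n. X n \<in> E" and sub: "\<And>n. submajorized 1 (X n) x"
    and lim: "(\<lambda>n. N (X n)) \<longlonglongrightarrow> N x"
  shows "\<exists>s. strict_mono s \<and>
    (\<lambda>n. N (\<lambda>t. rearrangement 1 x t - rearrangement 1 (X (s n)) t)) \<longlonglongrightarrow> 0"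
proof -
  obtain s where s: "strict_mono s"
    and count: "countable {t. liminf (\<lambda>n. rearrangement 1 (X (s n)) t) <
      limsup (\<lambda>n. rearrangement 1 (X (s n)) t)}"
    using Helly_antimono_ereal[of "\<lambda>n. rearrangement 1 (X n)"]
    by (auto intro: antimonoI rearrangement_antimono)
  define f where "f n = rearrangement 1 (X (s n))" for n
  \<comment> \<open>The lower limit exists at every point and inherits monotonicity and
    nonnegativity; almost everywhere it is the limit.\<close>
  define y where "y = (\<lambda>t. liminf (\<lambda>n. f n t))"
  have fE: "f n \<in> E" and Nf: "N (f n) = N (X (s n))" for n
    by (simp_all add: f_def mem_rearrangement norm_rearrangement X)
  have f_nonneg: "0 \<le> f n t" for n t
    by (simp add: f_def rearrangement_nonneg)
  have f_anti: "f n t' \<le> f n t" if "t \<le> t'" for n t t'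
    using that by (simp add: f_def rearrangement_antimono)
  have y_nonneg: "0 \<le> y t" for t
    unfolding y_def by (intro Liminf_bounded always_eventually allI f_nonneg)
  have y_anti: "y t' \<le> y t" if "t \<le> t'" for t t'
    unfolding y_def using that by (intro Liminf_mono always_eventually allI f_anti)
  have f_sub: "submajorized 1 (f n) x" for n
    using sub[of "s n"]
    by (simp add: submajorized_iff f_def rearrangement_integral_def rearrangement_idem mem_L0 X)
  have f_y: "AE t in lebesgue. (\<lambda>n. f n t) \<longlonglongrightarrow> y t"
  proof -
    have "{t. liminf (\<lambda>n. f n t) < limsup (\<lambda>n. f n t)} \<in> null_sets lebesgue"
      using count unfolding f_def
      by (intro null_sets_completionI countable_imp_null_set_lborel)
    then have "AE t in lebesgue. t \<notin> {t. liminf (\<lambda>n. f n t) < limsup (\<lambda>n. f n t)}"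
      by (rule AE_not_in)
    then show ?thesis
    proof eventually_elim
      case (elim t)
      moreover have "liminf (\<lambda>n. f n t) \<le> limsup (\<lambda>n. f n t)"
        by (rule Liminf_le_Limsup) simp
      ultimately show ?case
        unfolding y_def by (intro Liminf_eq_Limsup) auto
    qed
  qed
  obtain K where K: "\<And>n. N (f n) \<le> K"
  proof -
    obtain K where "\<And>n. \<bar>N (X n)\<bar> \<le> K"
      using convergent_imp_Bseq[OF convergentI[OF lim]] by (auto simp: Bseq_def)
    then have "N (f n) \<le> K" for n
      unfolding Nf by (meson abs_le_D1)
    then show ?thesis by (rule that)
  qed
  have yE: "y \<in> E"
  proof -
    \<comment> \<open>The Fatou property requires an increasing sequence: the tail infima increase
      to \<open>y\<close> and have norms bounded by those of \<open>f n\<close>.\<close>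
    define Z where "Z = (\<lambda>n t. INF m\<in>{n..}. f m t)"
    have [measurable]: "f m \<in> borel_measurable (leb 1)" for m
      using mem_L0[OF fE] by (simp add: L0_def)
    have ZL: "Z n \<in> L0 1" for n
      unfolding L0_def Z_def by (intro borel_measurable_INF) auto
    have Z_nonneg: "0 \<le> Z n t" for n t
      unfolding Z_def by (intro INF_greatest f_nonneg)
    have "Z n t \<le> f n t" for n t
      unfolding Z_def by (intro INF_lower) simp
    then have Z: "Z n \<in> E \<and> N (Z n) \<le> N (f n)" for n
      using Z_nonneg f_nonneg by (intro ideal ZL fE) auto
    have "incseq (\<lambda>n. Z n t)" for t
      unfolding Z_def by (intro incseq_SucI INF_superset_mono) auto
    moreover have "(\<lambda>n. Z n t) \<longlonglongrightarrow> y t" for t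
      using LIMSEQ_SUP[OF calculation] unfolding Z_def y_def liminf_SUP_INF by simp
    moreover have "bdd_above (range (\<lambda>n. N (Z n)))"
      using Z K by (meson bdd_aboveI2 order_trans)
    moreover have "y \<in> L0 1"
      unfolding L0_def y_def by simp
    ultimately show ?thesis
      using F Z Z_nonneg unfolding fatou_property_def pos_cone_def by blast
  qed
  \<comment> \<open>Fatou's lemma for integrals: since \<open>y\<close> and all \<open>f n\<close>
    are decreasing, their rearrangement integrals are integrals of the functions themselves.\<close>
  have y_sub: "submajorized 1 y x"
    unfolding submajorized_iff
  proof (intro allI impI)
    fix t :: real assume "0 < t"
    let ?i = "indicator ({0..t} \<inter> {0..<1}) :: real \<Rightarrow> ennreal"
    have f_eq: "(\<integral>\<^sup>+ r. e2ennreal (f n r) * ?i r \<partial>lebesgue) = rearrangement_integral 1 (f n) t" for n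
      using f_nonneg f_anti by (intro rearrangement_integral_eq_antimono[symmetric] mem_L0 fE) auto
    have [measurable]: "f n \<in> borel_measurable lebesgue" for n
      unfolding f_def by (intro rearrangement_measurable mem_L0 X)
    have [measurable]: "{0..t} \<inter> {0..<1} \<in> sets lebesgue" by simp
    have "rearrangement_integral 1 y t = (\<integral>\<^sup>+ r. e2ennreal (y r) * ?i r \<partial>lebesgue)"
      using y_nonneg y_anti by (intro rearrangement_integral_eq_antimono mem_L0 yE) auto
    also have "\<dots> \<le> (\<integral>\<^sup>+ r. liminf (\<lambda>n. e2ennreal (f n r) * ?i r) \<partial>lebesgue)"
    proof (rule nn_integral_mono_AE)
      show "AE r in lebesgue. e2ennreal (y r) * ?i r \<le> liminf (\<lambda>n. e2ennreal (f n r) * ?i r)"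
        using f_y
      proof eventually_elim
        case (elim r)
        then have "(\<lambda>n. e2ennreal (f n r)) \<longlonglongrightarrow> e2ennreal (y r)"
          by (rule tendsto_e2ennrealI)
        then have "liminf (\<lambda>n. e2ennreal (f n r)) = e2ennreal (y r)"
          by (rule lim_imp_Liminf[rotated]) simp
        then show ?case by (cases "r \<in> {0..t} \<inter> {0..<1}") (auto simp: indicator_def)
      qed
    qed
    also have "\<dots> \<le> liminf (\<lambda>n. \<integral>\<^sup>+ r. e2ennreal (f n r) * ?i r \<partial>lebesgue)"
      by (rule nn_integral_liminf) measurable
    also have "\<dots> \<le> rearrangement_integral 1 x t"
      unfolding f_eq
      using f_sub \<open>0 < t\<close> by (intro Liminf_le) (auto simp: submajorized_iff)
    finally show "rearrangement_integral 1 y t \<le> rearrangement_integral 1 x t" .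
  qed
  \<comment> \<open>The difference is split at \<open>d\<close>: near 0 both functions are small in
    norm separately, and beyond \<open>d\<close> they are bounded, so pointwise convergence
    suffices.\<close>
  have "(\<lambda>n. N (\<lambda>t. y t - f n t)) \<longlonglongrightarrow> 0"
  proof (rule LIMSEQ_I)
    fix e :: real assume "0 < e"
    have "rearrangement 1 x \<in> E" by (rule mem_rearrangement[OF x])
    from order_tendstoD(2)[OF norm_cut_tendsto[OF O this], of "e / 3"] \<open>0 < e\<close>
    obtain k where k: "N (cut (1 / real (Suc k)) (rearrangement 1 x)) < e / 3"
      by (auto simp: eventually_sequentially)
    define d where "d = 1 / real (Suc k)"
    have "0 < d" by (simp add: d_def)
    \<comment> \<open>A decreasing \<open>z\<close> keeps its submajorization after both sides are
      cut at \<open>d\<close>, so K-monotonicity carries the smallness of the cut of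
      \<open>rearrangement 1 x\<close> over to all such \<open>z\<close> at once.\<close>
    have tail: "N (cut d z) < e / 3"
      if z: "z \<in> E" "\<And>t. 0 \<le> z t" "\<And>t t'. t \<le> t' \<Longrightarrow> z t' \<le> z t" "submajorized 1 z x" for z
    proof -
      have "submajorized 1 z (rearrangement 1 x)"
        using z(4) by (simp add: submajorized_iff rearrangement_integral_def rearrangement_idem mem_L0 x)
      then have "submajorized 1 (cut d z) (cut d (rearrangement 1 x))"
        using z(1-3) \<open>0 < d\<close>
        by (intro submajorized_cut mem_L0 mem_rearrangement x rearrangement_nonneg rearrangement_antimono) auto
      then have "N (cut d z) \<le> N (cut d (rearrangement 1 x))"
        by (intro K_monotone[OF S] cut_mem mem_rearrangement x z(1))
      with k show ?thesis by (simp add: d_def)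
    qed
    obtain C where C: "\<And>z. z \<in> E \<Longrightarrow> submajorized 1 z x \<Longrightarrow> rearrangement 1 z d \<le> ereal C"
      using submajorized_imp_rearrangement_bound[OF S x \<open>0 < d\<close>] by blast
    have f_C: "f n t \<le> ereal C" if "d \<le> t" for n t
      using f_anti[OF that, of n] C[OF X sub, of "s n"] by (simp add: f_def)
    have y_C: "y t \<le> ereal C" if "d \<le> t" for t
      unfolding y_def using f_C[OF that] by (intro Liminf_le) auto
    \<comment> \<open>Beyond \<open>d\<close> both functions lie between 0 and \<open>C\<close>, so
      \<open>W n\<close> is dominated by a constant, and order continuity acts as dominated
      convergence in norm.\<close>
    define W where "W n t = (if t < d then 0 else \<bar>y t - f n t\<bar>)" for n t
    have WL: "W n \<in> L0 1" for n
    proof -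
      have "(\<lambda>t. y t - f n t) \<in> borel_measurable (leb 1)"
        using mem_L0[OF diff_closed[OF yE fE]] by (simp add: L0_def)
      then show ?thesis
        unfolding L0_def W_def by (intro measurable_If_less) auto
    qed
    have W_C: "\<bar>W n t\<bar> \<le> \<bar>ereal C\<bar>" for n t
    proof (cases "t < d")
      case False
      then have "y t \<le> ereal C" "f n t \<le> ereal C"
        by (simp_all add: y_C f_C)
      with False y_nonneg[of t] f_nonneg[of n t] show ?thesis
        unfolding W_def by (cases "y t"; cases "f n t") auto
    qed (simp add: W_def)
    have WE: "W n \<in> E" for n
      using ideal[OF WL const_mem, of n C] W_C by simp
    have "(\<lambda>n. N (W n)) \<longlonglongrightarrow> 0"
    proof (rule O[unfolded order_continuous_def, rule_format, OF const_mem[of C]], intro conjI allI)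
      show "W n \<in> pos_cone 1 E" for n
        using WE by (simp add: pos_cone_def W_def)
      show "AE t in leb 1. W n t \<le> \<bar>ereal C\<bar>" for n
      proof -
        have "W n t \<le> \<bar>ereal C\<bar>" for t
          using W_C[of n t] by (cases "W n t") auto
        then show ?thesis by simp
      qed
      show "AE t in leb 1. (\<lambda>n. W n t) \<longlonglongrightarrow> 0"
        unfolding AE_leb_one_iff using f_y
      proof eventually_elim
        case (elim t)
        show ?case
        proof (cases "t < d")
          case False
          then have "\<bar>y t\<bar> \<noteq> \<infinity>"
            using y_C[of t] y_nonneg[of t] by auto
          then have "(\<lambda>n. \<bar>y t - f n t\<bar>) \<longlonglongrightarrow> \<bar>y t - y t\<bar>"
            by (intro tendsto_abs_ereal tendsto_diff_ereal tendsto_const elim)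
          also have "\<bar>y t - y t\<bar> = 0"
            using \<open>\<bar>y t\<bar> \<noteq> \<infinity>\<close> by auto
          finally show ?thesis using False by (simp add: W_def)
        qed (simp add: W_def)
      qed
    qed
    then obtain n0 where n0: "\<And>n. n \<ge> n0 \<Longrightarrow> N (W n) < e / 3"
      using order_tendstoD(2)[of "\<lambda>n. N (W n)" 0 sequentially "e / 3"] \<open>0 < e\<close>
      by (auto simp: eventually_sequentially)
    have "norm (N (\<lambda>t. y t - f n t) - 0) < e" if "n \<ge> n0" for n
    proof -
      have cE: "(\<lambda>t. cut d y t + cut d (f n) t) \<in> E"
        by (intro add_closed cut_mem yE fE)
      have "\<bar>y t - f n t\<bar> \<le> \<bar>cut d y t + cut d (f n) t + W n t\<bar>" for t
        using y_nonneg[of t] f_nonneg[of n t]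
        by (cases "y t"; cases "f n t") (auto simp: W_def cut_def)
      then have "N (\<lambda>t. y t - f n t) \<le> N (\<lambda>t. cut d y t + cut d (f n) t + W n t)"
        by (intro ideal[THEN conjunct2] mem_L0 diff_closed yE fE add_closed[OF cE WE]) auto
      also have "\<dots> \<le> N (\<lambda>t. cut d y t + cut d (f n) t) + N (W n)"
        by (rule norm_triangle[OF cE WE])
      also have "N (\<lambda>t. cut d y t + cut d (f n) t) \<le> N (cut d y) + N (cut d (f n))"
        by (intro norm_triangle cut_mem yE fE)
      also have "N (cut d y) < e / 3"
        by (rule tail[OF yE y_nonneg y_anti y_sub])
      also have "N (cut d (f n)) < e / 3"
        by (rule tail[OF fE f_nonneg f_anti f_sub])
      also have "N (W n) < e / 3"
        by (rule n0[OF that])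
      finally show ?thesis
        using norm_nonneg[OF diff_closed[OF yE fE]] by simp
    qed
    then show "\<exists>n0. \<forall>n\<ge>n0. norm (N (\<lambda>t. y t - f n t) - 0) < e" by blast
  qed
  note y_f = this
  \<comment> \<open>The norms of \<open>f n\<close> tend to \<open>N x\<close>, while the triangle
    inequality bounds them by \<open>N y\<close> plus a null sequence.\<close>
  have "N x \<le> 0 + N y"
  proof (rule LIMSEQ_le)
    show "(\<lambda>n. N (X (s n))) \<longlonglongrightarrow> N x"
      using LIMSEQ_subseq_LIMSEQ[OF lim s] by (simp add: comp_def)
    show "(\<lambda>n. N (\<lambda>t. y t - f n t) + N y) \<longlonglongrightarrow> 0 + N y"
      by (intro tendsto_add y_f tendsto_const)
    have "N (f n) \<le> N (\<lambda>t. y t - f n t) + N y" for n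
    proof -
      have aE: "(\<lambda>t. \<bar>y t - f n t\<bar>) \<in> E"
        by (intro mem_abs diff_closed yE fE)
      have "\<bar>f n t\<bar> \<le> \<bar>\<bar>y t - f n t\<bar> + y t\<bar>" for t
        using y_nonneg[of t] f_nonneg[of n t] by (cases "y t"; cases "f n t") auto
      then have "N (f n) \<le> N (\<lambda>t. \<bar>y t - f n t\<bar> + y t)"
        by (intro ideal[THEN conjunct2] mem_L0 fE add_closed[OF aE yE]) auto
      also have "\<dots> \<le> N (\<lambda>t. \<bar>y t - f n t\<bar>) + N y"
        by (rule norm_triangle[OF aE yE])
      finally show ?thesis by (simp add: norm_abs diff_closed yE fE)
    qed
    then show "\<exists>n0. \<forall>n\<ge>n0. N (X (s n)) \<le> N (\<lambda>t. y t - f n t) + N y"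
      by (simp add: Nf)
  qed
  \<comment> \<open>Strict K-monotonicity now rules out different rearrangements. Since
    \<open>y\<close> is decreasing, it coincides almost everywhere with its own rearrangement, hence
    with that of \<open>x\<close>.\<close>
  then have "\<not> N y < N x" by simp
  then have eq: "rearrangement 1 x t = rearrangement 1 y t" if "t \<in> interval 1" for t
    using S x yE y_sub that unfolding strictly_K_monotone_def by blast
  have "AE t in leb 1. rearrangement 1 y t = y t"
    using y_nonneg y_anti by (intro rearrangement_antimono_AE mem_L0 yE) auto
  then have "AE t in leb 1. rearrangement 1 x t = y t"
    using AE_space by eventually_elim (simp add: eq)
  then have "AE t in leb 1. rearrangement 1 x t - f n t = y t - f n t" for n
    by eventually_elim simp
  then have "N (\<lambda>t. rearrangement 1 x t - f n t) = N (\<lambda>t. y t - f n t)" for n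
    by (intro AE_eq_imp[THEN conjunct2] mem_L0 diff_closed mem_rearrangement x yE fE)
  with y_f s show ?thesis
    by (auto simp: f_def)
qed

lemma lower_locally_uniformly_if_order_continuous:
  assumes S: "strictly_K_monotone 1 E N" and O: "order_continuous 1 E N"
    and F: "fatou_property 1 E N"
  shows "lower_locally_uniformly_K_monotone 1 E N"
  unfolding lower_locally_uniformly_K_monotone_def
proof (intro ballI allI impI, elim conjE)
  fix x X
  assume x: "x \<in> E" and X: "\<forall>n. X n \<in> E \<and> submajorized 1 (X n) x"
    and lim: "(\<lambda>n. N (X n)) \<longlonglongrightarrow> N x"
  show "(\<lambda>n. N (\<lambda>t. rearrangement 1 x t - rearrangement 1 (X n) t)) \<longlonglongrightarrow> 0"
  proof (rule LIMSEQ_if_subseq_LIMSEQ)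
    fix r :: "nat \<Rightarrow> nat" assume "strict_mono r"
    then have "(\<lambda>n. N (X (r n))) \<longlonglongrightarrow> N x"
      using LIMSEQ_subseq_LIMSEQ[OF lim] by (simp add: comp_def)
    then show "\<exists>s. strict_mono s \<and>
        (\<lambda>n. N (\<lambda>t. rearrangement 1 x t - rearrangement 1 (X (r (s n))) t)) \<longlonglongrightarrow> 0"
      using submajorized_convergent_subseq[OF S O F x, of "\<lambda>n. X (r n)"] X by simp
  qed
qed

end

theorem corollary3p8:
  fixes \<alpha> :: ereal
    and E :: "(real \<Rightarrow> ereal) set"
    and N :: "(real \<Rightarrow> ereal) \<Rightarrow> real"
  assumes "symmetric_space \<alpha> E N"
    and "fatou_property \<alpha> E N"
    and "\<alpha> < \<infinity>"
  shows "lower_locally_uniformly_K_monotone \<alpha> E N \<longleftrightarrow>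
    strictly_K_monotone \<alpha> E N \<and> order_continuous \<alpha> E N"
proof -
  have "\<alpha> = 1"
    using assms(1,3) banach_function_space.alpha symmetric_space.axioms(1) by fastforce
  then interpret unit_symmetric_space E N
    using assms(1) by (simp add: unit_symmetric_space_def)
  show ?thesis
    using strictly_K_monotone_if_lower_locally_uniformly
      order_continuous_if_lower_locally_uniformly
      lower_locally_uniformly_if_order_continuous assms(2)
    unfolding \<open>\<alpha> = 1\<close> by blast
qed

end
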